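(* Let $\delta:\mathbb{N}\to\mathbb{R}_{\ge 0}$ be a function. There is a constant $c$ such that the following holds for all positive integers $n$ and $k$ such that $k$ divides $n$ and $k \leq \sqrt{2\log n}$, for every labeled graph $H$ on $k$ nodes $\{1,\dots,k\}$, and for every labeled graph $G=(V,E)$ on $n$ nodes $V=\{1,\dots,n\}$ with $$C(E(G)\mid n) \geq \binom{n}{2} - \delta(n).$$ Put $p = 2^{-k(k-1)/2}$ and $$\alpha = \left( K(H\mid n) + \delta(n) + \log\left( \binom{n}{k}\Big/ \frac{n}{k}\right) + c \right)\frac{3}{\log e}.$$ Then $$\left| \#H(G) - \binom{n}{k} p \right| \leq \binom{n}{k}\sqrt{\alpha\, (k/n)\, p}.$$
   Context: $\log$ is the base-2 logarithm and $e$ is the base of natural logarithms. Kolmogorov complexity: natural numbers are identified with finite binary strings via $(0,\epsilon),(1,0),(2,1),(3,00),(4,01),\ldots$; $l(x)$ is the length of the string $x$. Let $T_0,T_1,\ldots$ be a standard enumeration of all Turing machines, $\langle\cdot,\cdot\rangle$ a standard one-one pairing $\mathbb{N}\times\mathbb{N}\to\mathbb{N}$ with $l(\langle x,y\rangle)=l(y)+O(l(x))$ (e.g. $\langle x,y\rangle = 1^{l(x)}0xy$), and $U$ a fixed universal Turing machine with $U(\langle\langle i,p\rangle,y\rangle)=T_i(\langle p,y\rangle)$ for all $i,p,y$. The conditional Kolmogorov complexity is $C(x\mid y)=\min\{l(p): p\in\{0,1\}^*,\ U(\langle p,y\rangle)=x\}$. The prefix Kolmogorov complexity $K(x\mid y)$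 is defined in the same way but with respect to a fixed universal machine for the class of Turing machines whose set of halting programs is prefix-free (no halting program is a proper prefix of another halting program). Graph encoding: graphs are simple and undirected. A labeled graph $G$ on nodes $\{1,\dots,n\}$ is identified with the binary string $E(G)$ of length $\binom{n}{2}$ whose $i$th bit is 1 if the $i$th possible edge (in a fixed order, e.g. lexicographic) is present and 0 otherwise. $K(H\mid n)$ means $K(E(H)\mid n)$. Subgraph count: for a $k$-element subset $\{i_1<i_2<\dots<i_k\}$ of $V$, the subgraph of $G$ induced on it is an ordered labeled occurrence of $H$ if relabeling $i_1,\dots,i_k$ as $1,\dots,k$ (in this order) yields exactly $H$. $\#H(G)$ is the number of $k$-element subsets of $V$ whose induced subgraph is an ordered labeled occurrence of $H$ (occurrences may overlap). *)

theory Defs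
  imports
    Complex_Main
    "HOL-Library.While_Combinator"
    "HOL-Library.Sublist"
    "HOL-Library.Ramsey"
begin

section \<open>Strings, numbers and pairing\<close>

type_synonym bits = "bool list"

text \<open>
  The length-lexicographic identification of natural numbers with binary strings:
  0 is the empty string, 1 is \<open>0\<close>, 2 is \<open>1\<close>, 3 is \<open>00\<close>, 4 is \<open>01\<close>, and so on.
\<close>

fun str :: "nat \<Rightarrow> bits" where
  "str 0 = []"
| "str (Suc n) = str (n div 2) @ [odd n]"

lemma bij_str: "bij str"
proof -
  define val :: "bits \<Rightarrow> nat" where
    "val = foldl (\<lambda>n b. 2 * n + (if b then 2 else 1)) 0"
  have "val (str n) = n" for n
    by (induction n rule: str.induct) (auto simp: val_def)
  moreover have "str (val x) = x" for x
    by (induction x rule: rev_induct) (auto simp: val_def)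
  ultimately show ?thesis
    by (intro o_bij[of val]) auto
qed

text \<open>The string \<open>1\<^sup>l\<^sup>(\<^sup>x\<^sup>)0xy\<close>.\<close>

definition pair :: "bits \<Rightarrow> bits \<Rightarrow> bits" where
  "pair x y = replicate (length x) True @ [False] @ x @ y"

lemma pair_eq_iff: "pair x y = pair x' y' \<longleftrightarrow> x = x' \<and> y = y'"
proof
  assume eq: "pair x y = pair x' y'"
  have "length (takeWhile id (pair x y)) = length x" for x y
    by (simp add: pair_def takeWhile_append)
  with eq have "length x = length x'"
    by metis
  with eq show "x = x' \<and> y = y'"
    by (simp add: pair_def)
qed simp

section \<open>Turing machines\<close>

text \<open>
  Single-tape machines with a tape that is infinite in both directions. A machine is a
  partial map from (state, scanned symbol) to (new state, written symbol, move) with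
  finite domain, so that it has only finitely many states and tape symbols;
  it starts in state 0 and halts as soon as no transition applies.
\<close>

datatype symbol = Blank | Bit bool | Aux nat

datatype move = GoLeft | Stay | GoRight

type_synonym tm = "nat \<times> symbol \<rightharpoonup> nat \<times> symbol \<times> move"

text \<open>State, head position and tape contents.\<close>

type_synonym config = "nat \<times> int \<times> (int \<Rightarrow> symbol)"

definition turing_machine :: "tm \<Rightarrow> bool" where
  "turing_machine M \<longleftrightarrow> finite (dom M)"

fun shift :: "move \<Rightarrow> int" where
  "shift GoLeft = - 1"
| "shift Stay = 0"
| "shift GoRight = 1"

definition tm_step :: "tm \<Rightarrow> config \<Rightarrow> config option" where
  "tm_step M = (\<lambda>(q, h, t). case M (q, t h) of
       None \<Rightarrow> None
     | Some (q', s, d) \<Rightarrow> Some (q', h + shift d, t(h := s)))"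

definition initial_config :: "bits \<Rightarrow> config" where
  "initial_config x =
     (0, 0, \<lambda>j. if 0 \<le> j \<and> j < int (length x) then Bit (x ! nat j) else Blank)"

text \<open>
  The output is the maximal string of bits that starts at the cell under the head and
  extends to the right (the empty string if that cell does not contain a bit).
\<close>

definition final_output :: "config \<Rightarrow> bits" where
  "final_output = (\<lambda>(q, h, t).
     map (\<lambda>j. t (h + int j) = Bit True) [0..<(LEAST m. \<forall>b. t (h + int m) \<noteq> Bit b)])"

text \<open>The partial function computed by a machine; \<open>None\<close> means that it does not halt.\<close>

definition tm_fun :: "tm \<Rightarrow> bits \<Rightarrow> bits option" where
  "tm_fun M x = map_option final_output
     (while_option (\<lambda>c. tm_step M c \<noteq> None) (\<lambda>c. the (tm_step M c)) (initial_config x))"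

text \<open>For every condition \<open>y\<close>, the set of halting programs is prefix-free.\<close>

definition prefix_machine :: "tm \<Rightarrow> bool" where
  "prefix_machine M \<longleftrightarrow> turing_machine M \<and>
     (\<forall>y p q. tm_fun M (pair p y) \<noteq> None \<and> tm_fun M (pair q y) \<noteq> None \<longrightarrow> \<not> strict_prefix p q)"

text \<open>
  \<open>U\<close> is a member of the class \<open>P\<close> and simulates all members of an enumeration
  \<open>T 0, T 1, \<dots>\<close> of that class. The enumeration is only required to be complete up to the
  partial functions computed: for prefix machines the set of machines itself is not
  recursively enumerable. That the enumeration is effective follows from \<open>U\<close> being a machine.
\<close>

definition universal_for :: "(tm \<Rightarrow> bool) \<Rightarrow> tm \<Rightarrow> bool" where
  "universal_for P U \<longleftrightarrow> P U \<and>
     (\<exists>T :: nat \<Rightarrow> tm.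
        (\<forall>i. P (T i)) \<and>
        (\<forall>M. P M \<longrightarrow> (\<exists>i. \<forall>p y. tm_fun (T i) (pair p y) = tm_fun M (pair p y))) \<and>
        (\<forall>i p y. tm_fun U (pair (pair (str i) p) y) = tm_fun (T i) (pair p y)))"

section \<open>Kolmogorov complexity\<close>

text \<open>
  With respect to a machine that is universal for all Turing machines this is the plain
  complexity \<open>C(x | y)\<close>; with respect to one that is universal for the prefix machines it is
  the prefix complexity \<open>K(x | y)\<close>. In both cases a program for \<open>x\<close> exists, so the minimum
  is over a nonempty set.
\<close>

definition complexity :: "tm \<Rightarrow> bits \<Rightarrow> bits \<Rightarrow> nat" where
  "complexity U x y = (LEAST m. \<exists>p. length p = m \<and> tm_fun U (pair p y) = Some x)"

section \<open>Labeled graphs\<close>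

text \<open>A labeled graph on the nodes \<open>1, \<dots>, n\<close> is given by its set of edges.\<close>

definition labeled_graph :: "nat \<Rightarrow> nat set set \<Rightarrow> bool" where
  "labeled_graph n G \<longleftrightarrow> G \<subseteq> nsets {1..n} 2"

text \<open>The characteristic string of the edge set, possible edges in lexicographic order.\<close>

definition encode :: "nat \<Rightarrow> nat set set \<Rightarrow> bits" where
  "encode n G = [{i, j} \<in> G. i \<leftarrow> [1..<n+1], j \<leftarrow> [i+1..<n+1]]"

lemma length_encode: "length (encode n G) = n choose 2"
proof -
  have "length (encode n G) = (\<Sum>i\<leftarrow>[1..<n+1]. n - i)"
    by (simp add: encode_def length_concat comp_def del: upt_Suc)
  also have "\<dots> = (\<Sum>i=1..n. n - i)"
    by (simp add: interv_sum_list_conv_sum_set_nat atLeastLessThanSuc_atLeastAtMost del: upt_Suc)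
  also have "\<dots> = (\<Sum>i<n. i)"
    by (rule sum.reindex_bij_witness[of _ "\<lambda>i. n - i" "\<lambda>i. n - i"]) auto
  also have "\<dots> = n choose 2"
    by (induction n) (auto simp: numeral_2_eq_2)
  finally show ?thesis .
qed

text \<open>For \<open>S = {i\<^sub>1 < \<dots> < i\<^sub>k}\<close>, \<open>rank S\<close> maps \<open>i\<^sub>j\<close> to \<open>j\<close>.\<close>

definition rank :: "nat set \<Rightarrow> nat \<Rightarrow> nat" where
  "rank S v = card {u \<in> S. u \<le> v}"

definition induced :: "nat set set \<Rightarrow> nat set \<Rightarrow> nat set set" where
  "induced G S = {e \<in> G. e \<subseteq> S}"

definition occurrence :: "nat set set \<Rightarrow> nat set set \<Rightarrow> nat set \<Rightarrow> bool" where
  "occurrence H G S \<longleftrightarrow> (\<lambda>e. rank S ` e) ` induced G S = H"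

definition occurrences :: "nat \<Rightarrow> nat set set \<Rightarrow> nat \<Rightarrow> nat set set \<Rightarrow> nat" where
  "occurrences k H n G = card {S \<in> nsets {1..n} k. occurrence H G S}"

end

theory Submission
  imports Defs "HOL-Library.Nat_Bijection"
begin

text \<open>
  Fix \<open>k\<close> and \<open>H\<close>. For a uniformly random graph on \<open>n\<close> nodes the number of occurrences of \<open>H\<close> has mean
  \<open>(n choose k) * p\<close>, and changing one edge changes it by at most \<open>n - 2 choose k - 2\<close>. McDiarmid's
  inequality therefore bounds the fraction of graphs whose deviation exceeds the claimed bound by
  about \<open>2 ^ - (\<delta> + log (n - 1 choose k - 1) + c)\<close>; here \<open>k \<le> sqrt (2 log n)\<close> makes \<open>n * p \<ge> 2 ^ (k / 2)\<close>
  large compared with \<open>k ^ 3\<close>, except for finitely many \<open>n\<close>, which are absorbed by \<open>c\<close>. As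
  \<open>2 ^ (k * k div 2) \<le> n\<close>, the term \<open>log (n - 1 choose k - 1)\<close> pays for taking the union over all \<open>k\<close>
  and \<open>H\<close>, so that neither has to be described and the complexity of \<open>H\<close> only helps.

  For given \<open>k\<close> and \<open>H\<close> rank all graphs by their deviation. The graphs of rank at most
  \<open>2 ^ (n choose 2 - r - k * k div 2)\<close> for some \<open>k\<close> and \<open>H\<close> number at most \<open>4 * 2 ^ (n choose 2 - r)\<close> and
  are decidable from \<open>n\<close> and \<open>r\<close>, so each of them has complexity at most \<open>n choose 2 - r + O(1)\<close>. The
  rank is computed by counting alone: neither \<open>\<delta>\<close> nor a logarithm enters the machine.
\<close>

section \<open>Register programs on Turing machines\<close>

text \<open>\<open>\<delta>\<close> is arbitrary, so the level \<open>r\<close> cannot be computed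
  from \<open>n\<close>, and writing it down would cost about \<open>log r\<close> further bits,
  which the constant \<open>c\<close> cannot pay. Therefore all programs of level \<open>r\<close>
  are padded to one common length, from which \<open>r\<close> is read off. All searches are bounded
  by explicit powers of 2, so primitive recursion suffices and every run halts. Running time does
  not matter, which is why registers may be kept in unary and ranks may be found by exhaustive
  counting. The estimates are lavish too. Exposing one edge at a time gives a tail with exponent
  \<open>d^2 / (N b^2)\<close>, where \<open>N = n choose 2\<close> and
  \<open>b = n - 2 choose k - 2\<close>. The claim needs \<open>N b^2\<close> to be at most
  \<open>3 (n choose k)^2 (k / n) p\<close>; the quotient of the two is
  \<open>6 (n - 1) / (k (k - 1)^2 2 ^ pairs k)\<close>. As \<open>n\<close> is at least
  \<open>2 ^ (pairs k + k div 2)\<close>, this quotient is large unless \<open>n\<close> is small,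
  so that losing a factor 2 in the exponent of McDiarmid's inequality is harmless.\<close>

definition steps :: "tm \<Rightarrow> config \<Rightarrow> config \<Rightarrow> bool" where
  "steps M = (\<lambda>c c'. tm_step M c = Some c')\<^sup>*\<^sup>*"

lemma steps_refl [simp]: "steps M c c"
  by (simp add: steps_def)

lemma steps_trans: "steps M c c' \<Longrightarrow> steps M c' c'' \<Longrightarrow> steps M c c''"
  by (simp add: steps_def)

lemma steps_step: "tm_step M c = Some c' \<Longrightarrow> steps M c c'"
  by (simp add: steps_def r_into_rtranclp)

lemma map_leD: "M \<subseteq>\<^sub>m M' \<Longrightarrow> M x = Some y \<Longrightarrow> M' x = Some y"
  by (metis domI map_le_def)

text \<open>Extending the partial map keeps every defined step and can only destroy halting. Hence
  machines with disjoint sets of states can be glued by \<open>++\<close>.\<close>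

lemma tm_step_mono: "M \<subseteq>\<^sub>m M' \<Longrightarrow> tm_step M c = Some c' \<Longrightarrow> tm_step M' c = Some c'"
  by (cases c) (auto simp: tm_step_def dest: map_leD split: option.splits)

lemma steps_mono: "M \<subseteq>\<^sub>m M' \<Longrightarrow> steps M c c' \<Longrightarrow> steps M' c c'"
  unfolding steps_def by (erule rtranclp_mono[THEN predicate2D, rotated]) (auto intro: tm_step_mono)

lemma tm_fun_eq_final_output:
  assumes "steps M (initial_config x) c" "tm_step M c = None"
  shows "tm_fun M x = Some (final_output c)"
proof -
  have "while_option (\<lambda>c. tm_step M c \<noteq> None) (\<lambda>c. the (tm_step M c)) c0 = Some c"
    if "steps M c0 c" for c0
    using that unfolding steps_def
    by (induction rule: converse_rtranclp_induct) (subst while_option_unfold, simp add: assms(2))+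
  then show ?thesis
    using assms(1) by (simp add: tm_fun_def)
qed

section \<open>Multi-track tapes over the symbols \<open>Aux\<close>\<close>

fun marks :: "symbol \<Rightarrow> nat set" where
  "marks (Aux m) = set_decode m"
| "marks _ = {}"

text \<open>The empty set is \<open>Blank\<close> and not \<open>Aux 0\<close>, so that the cells
  never visited already read as columns without marks.\<close>

definition mark_symbol :: "nat set \<Rightarrow> symbol" where
  "mark_symbol S = (if S = {} then Blank else Aux (set_encode S))"

lemma marks_mark_symbol: "finite S \<Longrightarrow> marks (mark_symbol S) = S"
  by (simp add: mark_symbol_def)

lemma mark_symbol_not_Bit [simp]: "mark_symbol S \<noteq> Bit b"
  by (simp add: mark_symbol_def)

text \<open>Bits belong to the alphabet because the output is written over the columns in place and
  the head then walks back across it.\<close>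

definition alphabet :: "nat \<Rightarrow> symbol set" where
  "alphabet r = mark_symbol ` Pow {..<r} \<union> range Bit"

lemma finite_alphabet: "finite (alphabet r)"
  by (simp add: alphabet_def)

text \<open>A control program on the states from \<open>a\<close> to \<open>b - 1\<close> that sees
  a cell only as its set of marked tracks. What it writes is cut down to the first \<open>r\<close>
  tracks, which keeps the alphabet finite.\<close>

definition gadget :: "nat \<Rightarrow> nat \<Rightarrow> nat \<Rightarrow> (nat \<Rightarrow> nat set \<Rightarrow> nat \<times> nat set \<times> move) \<Rightarrow> tm" where
  "gadget r a b \<delta> = (\<lambda>(q, z). if q \<in> {a..<b} \<and> z \<in> alphabet r
     then Some (case \<delta> q (marks z) of (q', S, d) \<Rightarrow> (q', mark_symbol (S \<inter> {..<r}), d)) else None)"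

lemma dom_gadget: "dom (gadget r a b \<delta>) = {a..<b} \<times> alphabet r"
  by (auto simp: gadget_def split: if_splits)

definition tape :: "nat \<Rightarrow> (nat \<Rightarrow> nat set) \<Rightarrow> int \<Rightarrow> symbol" where
  "tape r T = (\<lambda>j. if j < 0 then Blank else mark_symbol {x. x < r \<and> nat j \<in> T x})"

definition column :: "nat \<Rightarrow> (nat \<Rightarrow> nat set) \<Rightarrow> nat \<Rightarrow> nat set" where
  "column r T h = {x. x < r \<and> h \<in> T x}"

definition set_column :: "(nat \<Rightarrow> nat set) \<Rightarrow> nat \<Rightarrow> nat set \<Rightarrow> nat \<Rightarrow> nat set" where
  "set_column T h S = (\<lambda>x. if x \<in> S then insert h (T x) else T x - {h})"

lemma tape_cong: "(\<And>x. x < r \<Longrightarrow> T x = T' x) \<Longrightarrow> tape r T = tape r T'"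
  unfolding tape_def by (intro ext) (auto intro!: arg_cong[of _ _ mark_symbol])

lemma step_gadget:
  assumes "a \<le> q" "q < b" "\<delta> q (column r T h) = (q', S, d)"
  shows "tm_step (gadget r a b \<delta>) (q, int h, tape r T) =
    Some (q', int h + shift d, tape r (set_column T h S))"
proof -
  have "tape r T (int h) = mark_symbol (column r T h)"
    by (simp add: tape_def column_def)
  moreover have "mark_symbol (column r T h) \<in> alphabet r" "marks (mark_symbol (column r T h)) = column r T h"
    by (auto simp: alphabet_def column_def intro!: marks_mark_symbol)
  moreover have "(tape r T)(int h := mark_symbol (S \<inter> {..<r})) = tape r (set_column T h S)"
    unfolding tape_def set_column_def
    by (intro ext) (auto intro!: arg_cong[of _ _ mark_symbol])
  ultimately show ?thesis
    using assms by (simp add: tm_step_def gadget_def)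
qed

lemma step_gadget_keep:
  assumes "a \<le> q" "q < b" "\<delta> q (column r T h) = (q', column r T h, d)"
  shows "tm_step (gadget r a b \<delta>) (q, int h, tape r T) = Some (q', int h + shift d, tape r T)"
proof -
  have "tape r (set_column T h (column r T h)) = tape r T"
    by (rule tape_cong) (auto simp: set_column_def column_def)
  with step_gadget[of a q b \<delta> r T h, OF assms] show ?thesis
    by simp
qed

lemma walk_right:
  assumes "a \<le> q" "q < b" "x < r" "{h..<v} \<subseteq> T x" "h \<le> v"
    and "\<And>S. x \<in> S \<Longrightarrow> \<delta> q S = (q, S, GoRight)"
  shows "steps (gadget r a b \<delta>) (q, int h, tape r T) (q, int v, tape r T)"
  using assms(5,4)
proof (induction v rule: dec_induct)
  case (step v)
  then have "x \<in> column r T v"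
    using assms(3) by (auto simp: column_def)
  then have "tm_step (gadget r a b \<delta>) (q, int v, tape r T) = Some (q, int v + shift GoRight, tape r T)"
    using assms by (intro step_gadget_keep) auto
  moreover have "steps (gadget r a b \<delta>) (q, int h, tape r T) (q, int v, tape r T)"
    using step by (intro step.IH) (auto simp: subset_iff)
  ultimately show ?case
    by (auto intro: steps_trans steps_step simp: add.commute)
qed simp

lemma walk_left:
  assumes "a \<le> q" "q < b" "T 0 = {0}"
    and "\<And>S. 0 \<notin> S \<Longrightarrow> \<delta> q S = (q, S, GoLeft)"
  shows "steps (gadget r a b \<delta>) (q, int h, tape r T) (q, 0, tape r T)"
proof (induction h)
  case (Suc h)
  have "0 \<notin> column r T (Suc h)"
    using assms(3) by (auto simp: column_def)
  then have "tm_step (gadget r a b \<delta>) (q, int (Suc h), tape r T)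
      = Some (q, int (Suc h) + shift GoLeft, tape r T)"
    using assms by (intro step_gadget_keep) auto
  then show ?case
    using Suc by (auto intro: steps_trans steps_step)
qed simp

section \<open>Stores and the transformations that machines realize on them\<close>

type_synonym store = "(nat \<Rightarrow> nat) \<times> nat set"

text \<open>Track 0 marks the left end of the tape, track 1 carries a string of bits, and the register
  \<open>x\<close> is kept in unary on track \<open>x + 2\<close>.\<close>

definition tracks :: "store \<Rightarrow> nat \<Rightarrow> nat set" where
  "tracks \<sigma> x = (if x = 0 then {0} else if x = 1 then snd \<sigma> else {..<fst \<sigma> (x - 2)})"

lemma tracks_simps [simp]:
  "tracks \<sigma> 0 = {0}" "tracks \<sigma> (Suc 0) = snd \<sigma>" "tracks \<sigma> (Suc (Suc x)) = {..<fst \<sigma> x}"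
  by (auto simp: tracks_def)

text \<open>The head starts and ends in cell 0, and the exit state \<open>b\<close> has no
  transition of its own, so it can serve as the entry state of the next machine.\<close>

definition realizes :: "nat \<Rightarrow> tm \<Rightarrow> nat \<Rightarrow> nat \<Rightarrow> (store \<Rightarrow> store) \<Rightarrow> bool" where
  "realizes r M a b F \<longleftrightarrow> a \<le> b \<and> finite (dom M) \<and> fst ` dom M \<subseteq> {a..<b} \<and>
     (\<forall>\<sigma>. steps M (a, 0, tape r (tracks \<sigma>)) (b, 0, tape r (tracks (F \<sigma>))))"

text \<open>Composed programs must share one tape alphabet, so the number \<open>r\<close> of tracks
  is left open beyond a bound; the arbitrary entry state \<open>a\<close> makes the programs
  relocatable.\<close>

definition realizable :: "(store \<Rightarrow> store) \<Rightarrow> bool" where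
  "realizable F \<longleftrightarrow> (\<exists>R. \<forall>r\<ge>R. \<forall>a. \<exists>M b. realizes r M a b F)"

lemma realizable_id: "realizable (\<lambda>\<sigma>. \<sigma>)"
proof -
  have "realizes r Map.empty a a (\<lambda>\<sigma>. \<sigma>)" for r a
    by (simp add: realizes_def)
  then show ?thesis
    unfolding realizable_def by blast
qed

lemma dom_disjointI:
  assumes "fst ` dom M \<subseteq> X" "fst ` dom M' \<subseteq> Y" "X \<inter> Y = {}"
  shows "dom M \<inter> dom M' = {}"
proof (rule equals0I)
  fix p
  assume "p \<in> dom M \<inter> dom M'"
  then have "fst p \<in> X" "fst p \<in> Y"
    using assms(1,2) by (blast dest: subsetD[OF _ imageI])+
  with assms(3) show False
    by blast
qed

lemma map_le_map_add_disjoint: "dom M \<inter> dom M' = {} \<Longrightarrow> M \<subseteq>\<^sub>m M ++ M'"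
  by (subst map_add_comm) auto

lemma realizable_comp:
  assumes "realizable F" "realizable G"
  shows "realizable (\<lambda>\<sigma>. G (F \<sigma>))"
proof -
  obtain R R' where R: "\<And>r a. r \<ge> R \<Longrightarrow> \<exists>M b. realizes r M a b F"
    and R': "\<And>r a. r \<ge> R' \<Longrightarrow> \<exists>M b. realizes r M a b G"
    using assms unfolding realizable_def by meson
  have "\<exists>M b. realizes r M a b (\<lambda>\<sigma>. G (F \<sigma>))" if r: "r \<ge> max R R'" for r a
  proof -
    obtain M b where M: "realizes r M a b F"
      using R r by (meson max.boundedE)
    obtain M' b' where M': "realizes r M' b b' G"
      using R' r by (meson max.boundedE)
    have "dom M \<inter> dom M' = {}"
      using M M' unfolding realizes_def by fastforce
    then have sub: "M \<subseteq>\<^sub>m M ++ M'" "M' \<subseteq>\<^sub>m M ++ M'"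
      by (auto intro: map_le_map_add_disjoint)
    have "fst ` dom (M ++ M') \<subseteq> {a..<b'}"
      using M M' unfolding realizes_def by fastforce
    moreover have "finite (dom (M ++ M'))"
      using M M' by (simp add: realizes_def)
    ultimately have "realizes r (M ++ M') a b' (\<lambda>\<sigma>. G (F \<sigma>))"
      unfolding realizes_def
    proof (intro conjI allI)
      show "a \<le> b'"
        using M M' by (simp add: realizes_def)
      show "steps (M ++ M') (a, 0, tape r (tracks \<sigma>)) (b', 0, tape r (tracks (G (F \<sigma>))))" for \<sigma>
        using M M' by (meson realizes_def steps_trans steps_mono[OF sub(1)] steps_mono[OF sub(2)])
    qed auto
    then show ?thesis
      by blast
  qed
  then show ?thesis
    unfolding realizable_def by blast
qed

lemma realizes_gadgetI:
  assumes "a \<le> b" "\<And>\<sigma>. steps (gadget r a b \<delta>) (a, 0, tape r (tracks \<sigma>)) (b, 0, tape r (tracks (F \<sigma>)))"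
  shows "realizes r (gadget r a b \<delta>) a b F"
  using assms by (auto simp: realizes_def dom_gadget finite_alphabet)

lemma steps_gadgetI:
  assumes "a \<le> q" "q < b" "\<delta> q (column r T h) = (q', S, d)"
    and "steps (gadget r a b \<delta>) (q', int h + shift d, tape r (set_column T h S)) c"
  shows "steps (gadget r a b \<delta>) (q, int h, tape r T) c"
  using step_gadget[where \<delta> = \<delta>, OF assms(1-3)] assms(4) by (blast intro: steps_trans steps_step)

lemma steps_gadget_keepI:
  assumes "a \<le> q" "q < b" "\<delta> q (column r T h) = (q', column r T h, d)"
    and "steps (gadget r a b \<delta>) (q', int h + shift d, tape r T) c"
  shows "steps (gadget r a b \<delta>) (q, int h, tape r T) c"
  using step_gadget_keep[where \<delta> = \<delta>, OF assms(1-3)] assms(4) by (blast intro: steps_trans steps_step)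

lemma steps_return:
  assumes "a \<le> q" "q < b" "T 0 = {0}" "0 < r"
    and "\<And>S. \<delta> q S = (if 0 \<in> S then (q', S, Stay) else (q, S, GoLeft))"
  shows "steps (gadget r a b \<delta>) (q, int h, tape r T) (q', 0, tape r T)"
proof -
  have "steps (gadget r a b \<delta>) (q, int h, tape r T) (q, 0, tape r T)"
    using assms by (intro walk_left) auto
  moreover have "steps (gadget r a b \<delta>) (q, int 0, tape r T) (q', 0, tape r T)"
    using assms by (intro steps_gadget_keepI[where q' = q' and d = Stay]) (auto simp: column_def)
  ultimately show ?thesis
    by (auto intro: steps_trans)
qed

text \<open>The marks of register \<open>x\<close> fill the cells below its value, so the first
  unmarked cell is the one whose number is that value. In this way a register also addresses a bit
  on track 1.\<close>

lemma steps_seek: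
  assumes "a \<le> q" "q < b" "Suc (Suc x) < r"
    and "\<And>S. Suc (Suc x) \<in> S \<Longrightarrow> \<delta> q S = (q, S, GoRight)"
  shows "steps (gadget r a b \<delta>) (q, 0, tape r (tracks \<sigma>)) (q, int (fst \<sigma> x), tape r (tracks \<sigma>))"
  using walk_right[of a q b "Suc (Suc x)" r 0 "fst \<sigma> x" "tracks \<sigma>" \<delta>] assms
  by (simp add: lessThan_atLeast0)

section \<open>Basic instructions\<close>

definition inc :: "nat \<Rightarrow> store \<Rightarrow> store" where
  "inc x \<sigma> = ((fst \<sigma>)(x := Suc (fst \<sigma> x)), snd \<sigma>)"

definition dec :: "nat \<Rightarrow> store \<Rightarrow> store" where
  "dec x \<sigma> = ((fst \<sigma>)(x := fst \<sigma> x - 1), snd \<sigma>)"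

text \<open>Together with \<open>put_bit\<close> this is the only access to the string on track 1,
  at a position held in a register.\<close>

definition inc_if_bit :: "nat \<Rightarrow> nat \<Rightarrow> store \<Rightarrow> store" where
  "inc_if_bit x y \<sigma> = (if fst \<sigma> x \<in> snd \<sigma> then inc y \<sigma> else \<sigma>)"

definition put_bit :: "nat \<Rightarrow> nat \<Rightarrow> store \<Rightarrow> store" where
  "put_bit x y \<sigma> =
     (fst \<sigma>, if fst \<sigma> y = 0 then snd \<sigma> - {fst \<sigma> x} else insert (fst \<sigma> x) (snd \<sigma>))"

lemma set_column_inc:
  "Suc (Suc x) < r \<Longrightarrow> tape r (set_column (tracks \<sigma>) (fst \<sigma> x) (insert (Suc (Suc x)) (column r (tracks \<sigma>) (fst \<sigma> x))))
     = tape r (tracks (inc x \<sigma>))"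
  by (rule tape_cong) (auto simp: set_column_def column_def inc_def tracks_def split: if_splits)

lemma realizable_inc: "realizable (inc x)"
proof -
  have "\<exists>M b. realizes r M a b (inc x)" if r: "r \<ge> Suc (Suc (Suc x))" for r a
  proof -
    define \<delta> where "\<delta> q S = (if q = a then if Suc (Suc x) \<in> S then (a, S, GoRight) else (a + 1, insert (Suc (Suc x)) S, Stay)
      else if 0 \<in> S then (a + 2, S, Stay) else (a + 1, S, GoLeft))" for q :: nat and S :: "nat set"
    let ?M = "gadget r a (a + 2) \<delta>"
    have "steps ?M (a, 0, tape r (tracks \<sigma>)) (a + 2, 0, tape r (tracks (inc x \<sigma>)))" for \<sigma>
    proof (rule steps_trans)
      show "steps ?M (a, 0, tape r (tracks \<sigma>)) (a, int (fst \<sigma> x), tape r (tracks \<sigma>))"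
        using r by (intro steps_seek) (auto simp: \<delta>_def)
      have "steps ?M (a + 1, int (fst \<sigma> x), tape r (tracks (inc x \<sigma>))) (a + 2, 0, tape r (tracks (inc x \<sigma>)))"
        using r by (intro steps_return) (auto simp: \<delta>_def)
      then show "steps ?M (a, int (fst \<sigma> x), tape r (tracks \<sigma>)) (a + 2, 0, tape r (tracks (inc x \<sigma>)))"
        using r
        by (intro steps_gadgetI[where q' = "a + 1" and d = Stay
              and S = "insert (Suc (Suc x)) (column r (tracks \<sigma>) (fst \<sigma> x))"])
          (auto simp: \<delta>_def set_column_inc, auto simp: column_def)
    qed
    then have "realizes r ?M a (a + 2) (inc x)"
      by (intro realizes_gadgetI) auto
    then show ?thesis
      by blast
  qed
  then show ?thesis
    unfolding realizable_def by blast
qed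

lemma realizable_dec: "realizable (dec x)"
proof -
  have "\<exists>M b. realizes r M a b (dec x)" if r: "r \<ge> Suc (Suc (Suc x))" for r a
  proof -
    \<comment> \<open>Meeting the end marker without a mark of the register means that its value is
      0: the head is still in cell 0 and must not move left.\<close>
    define \<delta> where "\<delta> q S = (if q = a then if Suc (Suc x) \<in> S then (a, S, GoRight)
        else if 0 \<in> S then (a + 2, S, Stay) else (a + 1, S, GoLeft)
      else if q = a + 1 then (a + 2, S - {Suc (Suc x)}, Stay)
      else if 0 \<in> S then (a + 3, S, Stay) else (a + 2, S, GoLeft))" for q :: nat and S :: "nat set"
    let ?M = "gadget r a (a + 3) \<delta>"
    have return: "steps ?M (a + 2, int h, tape r (tracks \<sigma>)) (a + 3, 0, tape r (tracks \<sigma>))" for h \<sigma>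
      using r by (intro steps_return) (auto simp: \<delta>_def)
    have "steps ?M (a, 0, tape r (tracks \<sigma>)) (a + 3, 0, tape r (tracks (dec x \<sigma>)))" for \<sigma>
    proof (rule steps_trans)
      show "steps ?M (a, 0, tape r (tracks \<sigma>)) (a, int (fst \<sigma> x), tape r (tracks \<sigma>))"
        using r by (intro steps_seek) (auto simp: \<delta>_def)
      show "steps ?M (a, int (fst \<sigma> x), tape r (tracks \<sigma>)) (a + 3, 0, tape r (tracks (dec x \<sigma>)))"
      proof (cases "fst \<sigma> x")
        case 0
        then have "dec x \<sigma> = \<sigma>"
          by (simp add: dec_def fun_upd_idem)
        then show ?thesis
          using r 0 return[of 0 \<sigma>]
          by (intro steps_gadget_keepI[where q' = "a + 2" and d = Stay])
            (auto simp: \<delta>_def column_def)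
      next
        case (Suc v)
        have "tape r (set_column (tracks \<sigma>) v (column r (tracks \<sigma>) v - {Suc (Suc x)})) = tape r (tracks (dec x \<sigma>))"
          using Suc by (intro tape_cong) (auto simp: set_column_def column_def dec_def tracks_def split: if_splits)
        then have "steps ?M (a + 1, int v, tape r (tracks \<sigma>)) (a + 3, 0, tape r (tracks (dec x \<sigma>)))"
          using return[of v "dec x \<sigma>"]
          by (intro steps_gadgetI[where q' = "a + 2" and d = Stay and S = "column r (tracks \<sigma>) v - {Suc (Suc x)}"])
            (auto simp: \<delta>_def)
        then show ?thesis
          using r Suc
          by (intro steps_gadget_keepI[where q' = "a + 1" and d = GoLeft])
            (auto simp: \<delta>_def column_def)
      qed
    qed
    then have "realizes r ?M a (a + 3) (dec x)"
      by (intro realizes_gadgetI) auto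
    then show ?thesis
      by blast
  qed
  then show ?thesis
    unfolding realizable_def by blast
qed

lemma realizable_inc_if_bit: "realizable (inc_if_bit x y)"
proof -
  have "\<exists>M b. realizes r M a b (inc_if_bit x y)" if r: "r \<ge> Suc (Suc (Suc (x + y)))" for r a
  proof -
    \<comment> \<open>After a bit 1 has been read the head rewinds before it seeks the end of
      register \<open>y\<close>, because \<open>fst \<sigma> x\<close> may lie beyond that
      end.\<close>
    define \<delta> where "\<delta> q S = (if q = a then if Suc (Suc x) \<in> S then (a, S, GoRight)
        else if 1 \<in> S then (a + 1, S, Stay) else (a + 3, S, Stay)
      else if q = a + 1 then if 0 \<in> S then (a + 2, S, Stay) else (a + 1, S, GoLeft)
      else if q = a + 2 then if Suc (Suc y) \<in> S then (a + 2, S, GoRight) else (a + 3, insert (Suc (Suc y)) S, Stay)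
      else if 0 \<in> S then (a + 4, S, Stay) else (a + 3, S, GoLeft))" for q :: nat and S :: "nat set"
    let ?M = "gadget r a (a + 4) \<delta>"
    have return: "steps ?M (a + 3, int h, tape r (tracks \<sigma>)) (a + 4, 0, tape r (tracks \<sigma>))" for h \<sigma>
      using r by (intro steps_return) (auto simp: \<delta>_def)
    have "steps ?M (a, 0, tape r (tracks \<sigma>)) (a + 4, 0, tape r (tracks (inc_if_bit x y \<sigma>)))" for \<sigma>
    proof (rule steps_trans)
      show "steps ?M (a, 0, tape r (tracks \<sigma>)) (a, int (fst \<sigma> x), tape r (tracks \<sigma>))"
        using r by (intro steps_seek) (auto simp: \<delta>_def)
      show "steps ?M (a, int (fst \<sigma> x), tape r (tracks \<sigma>)) (a + 4, 0, tape r (tracks (inc_if_bit x y \<sigma>)))"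
      proof (cases "fst \<sigma> x \<in> snd \<sigma>")
        case True
        then have eq: "inc_if_bit x y \<sigma> = inc y \<sigma>"
          by (simp add: inc_if_bit_def)
        have "steps ?M (a + 2, int (fst \<sigma> y), tape r (tracks \<sigma>)) (a + 4, 0, tape r (tracks (inc y \<sigma>)))"
          using r return[of "fst \<sigma> y" "inc y \<sigma>"]
          by (intro steps_gadgetI[where q' = "a + 3" and d = Stay
                and S = "insert (Suc (Suc y)) (column r (tracks \<sigma>) (fst \<sigma> y))"])
            (auto simp: \<delta>_def set_column_inc, auto simp: column_def)
        moreover have "steps ?M (a + 2, 0, tape r (tracks \<sigma>)) (a + 2, int (fst \<sigma> y), tape r (tracks \<sigma>))"
          using r by (intro steps_seek) (auto simp: \<delta>_def)
        moreover have "steps ?M (a + 1, int (fst \<sigma> x), tape r (tracks \<sigma>)) (a + 2, 0, tape r (tracks \<sigma>))"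
          using r by (intro steps_return) (auto simp: \<delta>_def)
        ultimately have "steps ?M (a + 1, int (fst \<sigma> x), tape r (tracks \<sigma>)) (a + 4, 0, tape r (tracks (inc y \<sigma>)))"
          by (blast intro: steps_trans)
        then show ?thesis
          unfolding eq using r True
          by (intro steps_gadget_keepI[where q' = "a + 1" and d = Stay])
            (auto simp: \<delta>_def column_def)
      next
        case False
        then have eq: "inc_if_bit x y \<sigma> = \<sigma>"
          by (simp add: inc_if_bit_def)
        then show ?thesis
          unfolding eq using r False return[of "fst \<sigma> x" \<sigma>]
          by (intro steps_gadget_keepI[where q' = "a + 3" and d = Stay])
            (auto simp: \<delta>_def column_def)
      qed
    qed
    then have "realizes r ?M a (a + 4) (inc_if_bit x y)"
      by (intro realizes_gadgetI) auto
    then show ?thesis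
      by blast
  qed
  then show ?thesis
    unfolding realizable_def by blast
qed

lemma realizable_put_bit: "realizable (put_bit x y)"
proof -
  have "\<exists>M b. realizes r M a b (put_bit x y)" if r: "r \<ge> Suc (Suc (Suc (x + y)))" for r a
  proof -
    define \<delta> where "\<delta> q S = (if q = a then if Suc (Suc y) \<in> S then (a + 1, S, Stay) else (a + 2, S, Stay)
      else if q = a + 1 then if Suc (Suc x) \<in> S then (a + 1, S, GoRight) else (a + 3, insert 1 S, Stay)
      else if q = a + 2 then if Suc (Suc x) \<in> S then (a + 2, S, GoRight) else (a + 3, S - {1}, Stay)
      else if 0 \<in> S then (a + 4, S, Stay) else (a + 3, S, GoLeft))" for q :: nat and S :: "nat set"
    let ?M = "gadget r a (a + 4) \<delta>"
    have return: "steps ?M (a + 3, int h, tape r (tracks \<sigma>)) (a + 4, 0, tape r (tracks \<sigma>))" for h \<sigma>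
      using r by (intro steps_return) (auto simp: \<delta>_def)
    have "steps ?M (a, int 0, tape r (tracks \<sigma>)) (a + 4, 0, tape r (tracks (put_bit x y \<sigma>)))" for \<sigma>
    proof (cases "fst \<sigma> y = 0")
      case True
      have eq: "tape r (set_column (tracks \<sigma>) (fst \<sigma> x) (column r (tracks \<sigma>) (fst \<sigma> x) - {1}))
          = tape r (tracks (put_bit x y \<sigma>))"
        using True by (intro tape_cong) (auto simp: set_column_def column_def put_bit_def tracks_def split: if_splits)
      have "steps ?M (a + 2, 0, tape r (tracks \<sigma>)) (a + 2, int (fst \<sigma> x), tape r (tracks \<sigma>))"
        using r by (intro steps_seek) (auto simp: \<delta>_def)
      moreover have "steps ?M (a + 2, int (fst \<sigma> x), tape r (tracks \<sigma>)) (a + 4, 0, tape r (tracks (put_bit x y \<sigma>)))"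
        using r return[of "fst \<sigma> x" "put_bit x y \<sigma>"] eq
        by (intro steps_gadgetI[where q' = "a + 3" and d = Stay and S = "column r (tracks \<sigma>) (fst \<sigma> x) - {1}"])
           (auto simp: \<delta>_def, auto simp: column_def)
      ultimately have "steps ?M (a + 2, 0, tape r (tracks \<sigma>)) (a + 4, 0, tape r (tracks (put_bit x y \<sigma>)))"
        by (rule steps_trans)
      then show ?thesis
        using r True
        by (intro steps_gadget_keepI[where q' = "a + 2" and d = Stay])
          (auto simp: \<delta>_def column_def)
    next
      case False
      have eq: "tape r (set_column (tracks \<sigma>) (fst \<sigma> x) (insert 1 (column r (tracks \<sigma>) (fst \<sigma> x))))
          = tape r (tracks (put_bit x y \<sigma>))"
        using False by (intro tape_cong) (auto simp: set_column_def column_def put_bit_def tracks_def split: if_splits)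
      have "steps ?M (a + 1, 0, tape r (tracks \<sigma>)) (a + 1, int (fst \<sigma> x), tape r (tracks \<sigma>))"
        using r by (intro steps_seek) (auto simp: \<delta>_def)
      moreover have "steps ?M (a + 1, int (fst \<sigma> x), tape r (tracks \<sigma>)) (a + 4, 0, tape r (tracks (put_bit x y \<sigma>)))"
        using r return[of "fst \<sigma> x" "put_bit x y \<sigma>"] eq
        by (intro steps_gadgetI[where q' = "a + 3" and d = Stay and S = "insert 1 (column r (tracks \<sigma>) (fst \<sigma> x))"])
           (auto simp: \<delta>_def, auto simp: column_def)
      ultimately have "steps ?M (a + 1, 0, tape r (tracks \<sigma>)) (a + 4, 0, tape r (tracks (put_bit x y \<sigma>)))"
        by (rule steps_trans)
      then show ?thesis
        using r False
        by (intro steps_gadget_keepI[where q' = "a + 1" and d = Stay])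
          (auto simp: \<delta>_def column_def)
    qed
    then have "realizes r ?M a (a + 4) (put_bit x y)"
      by (intro realizes_gadgetI) auto
    then show ?thesis
      by blast
  qed
  then show ?thesis
    unfolding realizable_def by blast
qed

text \<open>The register is its own loop counter: since \<open>F\<close> lowers \<open>x\<close> by
  one, testing \<open>x\<close> for zero before each round gives exactly
  \<open>fst \<sigma> x\<close> rounds.\<close>

lemma realizable_loop:
  assumes "realizable F" and F: "\<And>\<sigma>. fst (F \<sigma>) x = fst \<sigma> x - 1"
  shows "realizable (\<lambda>\<sigma>. (F ^^ fst \<sigma> x) \<sigma>)"
proof -
  obtain R where R: "\<And>r a. r \<ge> R \<Longrightarrow> \<exists>M b. realizes r M a b F"
    using assms(1) unfolding realizable_def by meson
  have "\<exists>M b. realizes r M a b (\<lambda>\<sigma>. (F ^^ fst \<sigma> x) \<sigma>)" if r: "r \<ge> max R (Suc (Suc (Suc x)))" for r a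
  proof -
    obtain M b where M: "realizes r M (Suc a) b F"
      using R r by (meson max.boundedE)
    \<comment> \<open>Cell 0 is marked for \<open>x\<close> iff the register is nonzero, so the test
      needs no walk. The body occupies the states from \<open>a + 1\<close> on, its exit state
      \<open>b\<close> jumps back to \<open>a\<close>, and the loop is left in state
      \<open>b + 1\<close>.\<close>
    define test where "test = gadget r a (Suc a)
      (\<lambda>q S. if Suc (Suc x) \<in> S then (Suc a, S, Stay) else (Suc b, S, Stay))"
    define jump where "jump = gadget r b (Suc b) (\<lambda>q S. (a, S, Stay))"
    let ?M = "test ++ M ++ jump"
    have b: "Suc a \<le> b" and states: "fst ` dom M \<subseteq> {Suc a..<b}"
      using M by (auto simp: realizes_def)
    have range: "fst ` dom test \<subseteq> {a}" "fst ` dom jump \<subseteq> {b}"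
      unfolding test_def jump_def dom_gadget by auto
    have dom: "dom M \<inter> dom jump = {}" "dom test \<inter> dom M = {}" "dom test \<inter> dom jump = {}"
      by (rule dom_disjointI[OF states range(2)], simp) (rule dom_disjointI[OF range(1) states] dom_disjointI[OF range], use b in simp)+
    have "dom test \<inter> dom (M ++ jump) = {}"
      unfolding dom_map_add using dom by blast
    then have sub: "test \<subseteq>\<^sub>m ?M"
      unfolding map_add_assoc[symmetric] by (rule map_le_map_add_disjoint)
    have "M \<subseteq>\<^sub>m M ++ jump"
      using dom(1) by (rule map_le_map_add_disjoint)
    then have sub': "M \<subseteq>\<^sub>m ?M"
      unfolding map_add_assoc[symmetric] by (rule map_le_trans) (rule map_le_map_add)
    have sub'': "jump \<subseteq>\<^sub>m ?M"
      by simp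
    have enter: "steps ?M (a, 0, tape r (tracks \<sigma>)) (if fst \<sigma> x = 0 then Suc b else Suc a, 0, tape r (tracks \<sigma>))" for \<sigma>
      using step_gadget_keep[of a a "Suc a" "\<lambda>q S. if Suc (Suc x) \<in> S then (Suc a, S, Stay) else (Suc b, S, Stay)" r "tracks \<sigma>" 0
         "if fst \<sigma> x = 0 then Suc b else Suc a" Stay] r
      by (intro steps_mono[OF sub] steps_step) (auto simp: test_def column_def)
    have "steps ?M (b, 0, tape r (tracks \<sigma>)) (a, 0, tape r (tracks \<sigma>))" for \<sigma>
      using step_gadget_keep[of b b "Suc b" "\<lambda>q S. (a, S, Stay)" r "tracks \<sigma>" 0 a Stay]
      by (intro steps_mono[OF sub''] steps_step) (auto simp: jump_def)
    moreover have "steps ?M (Suc a, 0, tape r (tracks \<sigma>)) (b, 0, tape r (tracks (F \<sigma>)))" for \<sigma>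
      using M unfolding realizes_def by (blast intro: steps_mono[OF sub'])
    ultimately have round: "steps ?M (Suc a, 0, tape r (tracks \<sigma>)) (a, 0, tape r (tracks (F \<sigma>)))" for \<sigma>
      by (blast intro: steps_trans)
    have "steps ?M (a, 0, tape r (tracks \<sigma>)) (Suc b, 0, tape r (tracks ((F ^^ v) \<sigma>)))" if "v = fst \<sigma> x" for v \<sigma>
      using that
    proof (induction v arbitrary: \<sigma>)
      case 0
      then show ?case
        using enter[of \<sigma>] by simp
    next
      case (Suc v)
      then have "v = fst (F \<sigma>) x"
        by (simp add: F flip: Suc.prems)
      then have "steps ?M (a, 0, tape r (tracks (F \<sigma>))) (Suc b, 0, tape r (tracks ((F ^^ Suc v) \<sigma>)))"
        using Suc.IH[of "F \<sigma>"] by (simp add: funpow_swap1)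
      moreover have "steps ?M (a, 0, tape r (tracks \<sigma>)) (Suc a, 0, tape r (tracks \<sigma>))"
        using enter[of \<sigma>] by (simp flip: Suc.prems)
      ultimately show ?case
        using round by (blast intro: steps_trans)
    qed
    moreover have "finite (dom ?M)"
      using M by (simp add: test_def jump_def dom_gadget finite_alphabet realizes_def)
    moreover have "fst ` dom ?M \<subseteq> {a..<Suc b}"
      unfolding dom_map_add image_Un using b states range by fastforce
    ultimately have "realizes r ?M a (Suc b) (\<lambda>\<sigma>. (F ^^ fst \<sigma> x) \<sigma>)"
      using b unfolding realizes_def by auto
    then show ?thesis
      by blast
  qed
  then show ?thesis
    unfolding realizable_def by blast
qed

section \<open>Input and output\<close>

definition store_of :: "bits \<Rightarrow> store" where
  "store_of w = ((\<lambda>_. 0)(0 := length w), {j. j < length w \<and> w ! j})"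

lemma load_input:
  assumes "2 < r"
  shows "\<exists>M b. finite (dom M) \<and> fst ` dom M \<subseteq> {0..<b} \<and>
    (\<forall>w. steps M (initial_config w) (b, 0, tape r (tracks (store_of w))))"
proof -
  \<comment> \<open>The input is converted in place: track 1 takes the bit, and track 2, which is
    register 0, counts the length, since the positions of the ones alone would lose trailing zeros.
    Only state 0, in the first cell, also sets the end marker; state 2 is the way back.\<close>
  define start where "start = (\<lambda>(q :: nat, z). if q < 2 \<and> z \<in> insert Blank (range Bit) then Some (case z of
       Bit b \<Rightarrow> (1 :: nat, mark_symbol ((if q = 0 then {0, 2} else {2}) \<union> (if b then {1} else {})), GoRight)
     | _ \<Rightarrow> if q = 0 then (3, mark_symbol {0}, Stay) else (2, z, GoLeft)) else None)"
  define \<delta> :: "nat \<Rightarrow> nat set \<Rightarrow> nat \<times> nat set \<times> move"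
    where "\<delta> = (\<lambda>q S. if 0 \<in> S then (3, S, Stay) else (2, S, GoLeft))"
  let ?G = "gadget r 2 3 \<delta>"
  let ?M = "start ++ ?G"
  have dom_start: "dom start = {..<2} \<times> insert Blank (range Bit)"
    by (auto simp: start_def split: if_splits)
  have disj: "dom start \<inter> dom ?G = {}"
    by (auto simp: dom_start dom_gadget)
  have sub: "start \<subseteq>\<^sub>m ?M"
    using disj by (rule map_le_map_add_disjoint)
  have "steps ?M (initial_config w) (3, 0, tape r (tracks (store_of w)))" for w
  proof -
    define t where "t = tape r (tracks (store_of w))"
    define t0 where "t0 = snd (snd (initial_config w))"
    define mixed where "mixed i = (\<lambda>j. if j < int i then t j else t0 j)" for i
    have t: "t j = (if j < 0 then Blank else if j < int (length w) then
        mark_symbol ((if j = 0 then {0, 2} else {2}) \<union> (if w ! nat j then {1} else {}))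
      else mark_symbol (if j = 0 then {0} else {}))" for j
      using assms unfolding t_def tape_def store_of_def
      by (auto intro!: arg_cong[of _ _ mark_symbol] simp: tracks_def less_2_cases_iff split: if_splits)
    have t0: "t0 j = (if 0 \<le> j \<and> j < int (length w) then Bit (w ! nat j) else Blank)" for j
      by (simp add: t0_def initial_config_def)
    have init: "initial_config w = (0, 0, mixed 0)"
      unfolding mixed_def by (auto simp: initial_config_def t0 t mark_symbol_def)
    have mixed_Suc: "mixed (Suc i) = (mixed i)(int i := t (int i))" for i
      by (auto simp: mixed_def)
    have return: "steps ?M (2, int h, t) (3, 0, t)" for h
      unfolding t_def
      by (rule steps_mono[of ?G]) (use assms in \<open>auto intro!: steps_return simp: \<delta>_def\<close>)
    have copy: "tm_step start (q, int i, mixed i) = Some (1, int (Suc i), mixed (Suc i))"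
      if "i < length w" "q < 2" "q = 0 \<longleftrightarrow> i = 0" for i q
    proof -
      have "t (int i) = mark_symbol ((if q = 0 then {0, 2} else {2}) \<union> (if w ! i then {1} else {}))"
        using that t[of "int i"] by simp
      moreover have "mixed i (int i) = Bit (w ! i)"
        using that by (simp add: mixed_def t0)
      ultimately show ?thesis
        using that(2) by (simp add: tm_step_def start_def mixed_Suc)
    qed
    have "steps ?M (initial_config w) (3, 0, t)"
    proof (cases "w = []")
      case True
      have "mixed 0 0 = Blank" "mixed (Suc 0) = t"
        using True by (auto simp: mixed_def t0 t mark_symbol_def)
      then have "tm_step start (0, 0, mixed 0) = Some (3, 0, t)"
        using True mixed_Suc[of 0] t[of 0] by (simp add: tm_step_def start_def)
      then show ?thesis
        unfolding init by (intro steps_mono[OF sub] steps_step)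
    next
      case False
      have "steps start (1, int 1, mixed 1) (1, int i, mixed i)" if "1 \<le> i" "i \<le> length w" for i
        using that
      proof (induction i rule: dec_induct)
        case (step i)
        then show ?case
          using copy[of i 1] by (auto intro: steps_trans steps_step)
      qed simp
      moreover have "tm_step start (0, int 0, mixed 0) = Some (1, int 1, mixed 1)"
        using False copy[of 0 0] by simp
      ultimately have "steps start (0, int 0, mixed 0) (1, int (length w), mixed (length w))"
        using False by (auto intro: steps_trans[OF steps_step] simp: Suc_le_eq)
      moreover have "mixed (length w) = t"
        using False by (intro ext) (auto simp: mixed_def t0 t mark_symbol_def)
      moreover have "tm_step start (1, int (length w), t) = Some (2, int (length w - 1), t)"
        using False t[of "int (length w)"]
        by (auto simp: tm_step_def start_def mark_symbol_def of_nat_diff Suc_le_eq fun_upd_idem)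
      ultimately have "steps start (0, int 0, mixed 0) (2, int (length w - 1), t)"
        by (simp only: steps_trans[OF _ steps_step])
      then have "steps ?M (0, int 0, mixed 0) (2, int (length w - 1), t)"
        by (rule steps_mono[OF sub])
      then have "steps ?M (0, int 0, mixed 0) (3, 0, t)"
        using return by (rule steps_trans)
      then show ?thesis
        by (simp add: init)
    qed
    then show ?thesis
      by (simp add: t_def)
  qed
  moreover have "finite (dom ?M)" "fst ` dom ?M \<subseteq> {0..<3}"
    unfolding dom_map_add dom_start dom_gadget by (auto simp: finite_alphabet)
  ultimately show ?thesis
    by blast
qed

lemma write_output:
  assumes "Suc (Suc t) < r"
  shows "\<exists>M. finite (dom M) \<and> fst ` dom M \<subseteq> {a..} \<and>
    (\<forall>\<sigma>. \<exists>c. steps M (a, 0, tape r (tracks \<sigma>)) c \<and> (\<forall>z. fst c \<notin> fst ` dom M) \<and> a \<le> fst c \<and>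
      final_output c = map (\<lambda>j. j \<in> snd \<sigma>) [0..<fst \<sigma> t])"
proof -
  \<comment> \<open>Writing a bit into cell 0 destroys the end marker, so the way back is stopped by
    the blank cell -1 instead. The output ends at cell \<open>fst \<sigma> t\<close>, which still
    holds a column and hence no bit.\<close>
  define M where "M = (\<lambda>(q, z). if q \<in> {a, a + 1} \<and> z \<in> insert Blank (alphabet r) then Some (
      if q = a then if Suc (Suc t) \<in> marks z then (a, Bit (1 \<in> marks z), GoRight) else (a + 1, z, GoLeft)
      else if z = Blank then (a + 2, z, GoRight) else (a + 1, z, GoLeft)) else None)"
  have dom: "dom M = {a, a + 1} \<times> insert Blank (alphabet r)"
    by (auto simp: M_def split: if_splits)
  have "\<exists>c. steps M (a, 0, tape r (tracks \<sigma>)) c \<and> (\<forall>z. fst c \<notin> fst ` dom M) \<and> a \<le> fst c \<and>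
      final_output c = map (\<lambda>j. j \<in> snd \<sigma>) [0..<fst \<sigma> t]" for \<sigma>
  proof -
    let ?N = "fst \<sigma> t"
    define w where "w = tape r (tracks \<sigma>)"
    define mixed where "mixed i = (\<lambda>j. if 0 \<le> j \<and> j < int i then Bit (nat j \<in> snd \<sigma>) else w j)" for i
    have w: "w (int j) \<in> alphabet r" "marks (w (int j)) = column r (tracks \<sigma>) j" for j
      unfolding w_def tape_def column_def by (auto simp: alphabet_def marks_mark_symbol)
    have w_neg: "w j = Blank" if "j < 0" for j
      using that by (simp add: w_def tape_def)
    have mixed_alphabet: "mixed i (int j) \<in> alphabet r" for i j
      using w by (auto simp: mixed_def alphabet_def)
    have "tm_step M (a, int i, mixed i) = Some (a, int (Suc i), mixed (Suc i))" if "i < ?N" for i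
    proof -
      have "mixed i (int i) = w (int i)" "mixed (Suc i) = (mixed i)(int i := Bit (i \<in> snd \<sigma>))"
        by (auto simp: mixed_def)
      then show ?thesis
        using w[of i] that assms by (simp add: tm_step_def M_def column_def)
    qed
    then have "steps M (a, int 0, mixed 0) (a, int i, mixed i)" if "i \<le> ?N" for i
      using that
    proof (induction i)
      case (Suc i)
      then show ?case
        by (meson Suc_leD Suc_le_eq steps_step steps_trans)
    qed simp
    moreover have "tm_step M (a, int ?N, mixed ?N) = Some (a + 1, int ?N - 1, mixed ?N)"
      using w[of ?N] assms by (simp add: tm_step_def M_def column_def mixed_def fun_upd_idem)
    ultimately have 1: "steps M (a, int 0, mixed 0) (a + 1, int ?N - 1, mixed ?N)"
      by (meson order_refl steps_step steps_trans)
    have "steps M (a + 1, int i - 1, mixed ?N) (a + 1, - 1, mixed ?N)" if "i \<le> ?N" for i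
      using that
    proof (induction i)
      case (Suc i)
      have "mixed ?N (int i) = Bit (i \<in> snd \<sigma>)"
        using Suc by (simp add: mixed_def)
      then have "tm_step M (a + 1, int i, mixed ?N) = Some (a + 1, int i - 1, mixed ?N)"
        using mixed_alphabet[of ?N i] by (simp add: tm_step_def M_def fun_upd_idem)
      then show ?case
        using Suc by (auto intro: steps_trans steps_step)
    qed simp
    then have 2: "steps M (a + 1, int ?N - 1, mixed ?N) (a + 1, - 1, mixed ?N)"
      by blast
    have "tm_step M (a + 1, - 1, mixed ?N) = Some (a + 2, 0, mixed ?N)"
      using w_neg[of "-1"] by (simp add: tm_step_def M_def mixed_def fun_upd_idem)
    then have "steps M (a, int 0, mixed 0) (a + 2, 0, mixed ?N)"
      by (meson 1 2 steps_step steps_trans)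
    moreover have "mixed 0 = tape r (tracks \<sigma>)"
      by (intro ext) (auto simp: mixed_def w_def)
    moreover have "final_output (a + 2, 0, mixed ?N) = map (\<lambda>j. j \<in> snd \<sigma>) [0..<?N]"
    proof -
      have "(LEAST m. \<forall>b. mixed ?N (0 + int m) \<noteq> Bit b) = ?N"
      proof (rule Least_equality)
        show "\<forall>b. mixed ?N (0 + int ?N) \<noteq> Bit b"
          by (simp add: mixed_def w_def tape_def)
        show "?N \<le> m" if "\<forall>b. mixed ?N (0 + int m) \<noteq> Bit b" for m
          using that by (auto simp: mixed_def split: if_splits)
      qed
      then show ?thesis
        by (simp add: final_output_def) (simp add: mixed_def)
    qed
    ultimately show ?thesis
      by (intro exI[of _ "(a + 2, 0, mixed ?N)"]) (auto simp: dom)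
  qed
  moreover have "finite (dom M)" "fst ` dom M \<subseteq> {a..}"
    by (auto simp: dom finite_alphabet)
  ultimately show ?thesis
    by blast
qed

lemma realizable_imp_tm_fun:
  assumes "realizable F"
  shows "\<exists>M. turing_machine M \<and> (\<forall>w. tm_fun M w =
    Some (map (\<lambda>j. j \<in> snd (F (store_of w))) [0..<fst (F (store_of w)) t]))"
proof -
  obtain R where R: "\<And>r a. r \<ge> R \<Longrightarrow> \<exists>M b. realizes r M a b F"
    using assms unfolding realizable_def by meson
  \<comment> \<open>Enough tracks for \<open>F\<close>, for the output register on track
    \<open>t + 2\<close>, and for tracks 0 to 2 of the loader.\<close>
  define r where "r = R + t + 3"
  obtain M1 b where fin1: "finite (dom M1)" and states1: "fst ` dom M1 \<subseteq> {0..<b}"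
    and steps1: "\<And>w. steps M1 (initial_config w) (b, 0, tape r (tracks (store_of w)))"
    using load_input[of r] unfolding r_def by auto
  obtain M2 e where M2: "realizes r M2 b e F"
    using R[of r b] by (auto simp: r_def)
  then have fin2: "finite (dom M2)" and states2: "fst ` dom M2 \<subseteq> {b..<e}" and "b \<le> e"
    and steps2: "\<And>\<sigma>. steps M2 (b, 0, tape r (tracks \<sigma>)) (e, 0, tape r (tracks (F \<sigma>)))"
    unfolding realizes_def by blast+
  obtain M3 where fin3: "finite (dom M3)" and states3: "fst ` dom M3 \<subseteq> {e..}"
    and steps3: "\<And>\<sigma>. \<exists>c. steps M3 (e, 0, tape r (tracks \<sigma>)) c \<and> (\<forall>z. fst c \<notin> fst ` dom M3) \<and> e \<le> fst c \<and>
      final_output c = map (\<lambda>j. j \<in> snd \<sigma>) [0..<fst \<sigma> t]"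
    using write_output[of t r e] unfolding r_def by auto
  let ?M = "M1 ++ (M2 ++ M3)"
  have disj23: "dom M2 \<inter> dom M3 = {}"
    by (rule dom_disjointI[OF states2 states3]) auto
  have "fst ` dom (M2 ++ M3) \<subseteq> {b..}"
    unfolding dom_map_add image_Un using states2 states3 \<open>b \<le> e\<close> by fastforce
  then have sub1: "M1 \<subseteq>\<^sub>m ?M"
    by (intro map_le_map_add_disjoint dom_disjointI[OF states1]) auto
  have sub2: "M2 \<subseteq>\<^sub>m ?M"
    using map_le_map_add_disjoint[OF disj23] map_le_map_add map_le_trans by blast
  have sub3: "M3 \<subseteq>\<^sub>m ?M"
    using map_le_map_add map_le_trans by blast
  have "tm_fun ?M w = Some (map (\<lambda>j. j \<in> snd (F (store_of w))) [0..<fst (F (store_of w)) t])" for w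
  proof -
    obtain c where c: "steps M3 (e, 0, tape r (tracks (F (store_of w)))) c" "fst c \<notin> fst ` dom M3" "e \<le> fst c"
      "final_output c = map (\<lambda>j. j \<in> snd (F (store_of w))) [0..<fst (F (store_of w)) t]"
      using steps3 by blast
    have "fst c \<notin> fst ` dom ?M"
      unfolding dom_map_add image_Un using c(2,3) states1 states2 \<open>b \<le> e\<close> by fastforce
    then have "?M (fst c, z) = None" for z
      by (metis domIff fst_conv image_eqI)
    then have "tm_step ?M c = None"
      unfolding tm_step_def by (simp add: case_prod_unfold del: map_add_None)
    moreover have "steps ?M (initial_config w) c"
      by (meson steps_trans steps_mono[OF sub1 steps1] steps_mono[OF sub2 steps2] steps_mono[OF sub3 c(1)])
    ultimately show ?thesis
      using tm_fun_eq_final_output[of ?M w c] c(4) by simp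
  qed
  moreover have "turing_machine ?M"
    using fin1 fin2 fin3 by (simp add: turing_machine_def)
  ultimately show ?thesis
    by blast
qed

section \<open>Computable functions\<close>

declare split_paired_All [simp del]

text \<open>A stack discipline: everything below \<open>m\<close> and the string survive, the result
  goes to \<open>m\<close>, and the registers above \<open>m\<close> are scratch space with
  arbitrary contents before and after.\<close>

definition computes :: "nat \<Rightarrow> (nat set \<Rightarrow> nat list \<Rightarrow> nat) \<Rightarrow> nat list \<Rightarrow> (store \<Rightarrow> store) \<Rightarrow> bool" where
  "computes m f rs F \<longleftrightarrow> realizable F \<and> (\<forall>\<sigma>. snd (F \<sigma>) = snd \<sigma> \<and>
     fst (F \<sigma>) m = f (snd \<sigma>) (map (fst \<sigma>) rs) \<and> (\<forall>x<m. fst (F \<sigma>) x = fst \<sigma> x))"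

text \<open>The first argument is the number of arguments; the set of numbers is an oracle.\<close>

definition computable :: "nat \<Rightarrow> (nat set \<Rightarrow> nat list \<Rightarrow> nat) \<Rightarrow> bool" where
  "computable l f \<longleftrightarrow>
     (\<forall>rs m. length rs = l \<and> set rs \<subseteq> {..<m} \<longrightarrow> (\<exists>F. computes m f rs F))"

lemma computableI:
  assumes "\<And>rs m. length rs = l \<Longrightarrow> set rs \<subseteq> {..<m} \<Longrightarrow> \<exists>F. computes m f rs F"
  shows "computable l f"
  using assms by (auto simp: computable_def)

lemma computableE:
  assumes "computable l f" "length rs = l" "set rs \<subseteq> {..<m}"
  obtains F where "computes m f rs F"
  using assms unfolding computable_def by blast

lemma computable_cong:
  assumes "\<And>B v. length v = l \<Longrightarrow> f B v = g B v" "computable l f"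
  shows "computable l g"
  using assms unfolding computable_def computes_def by auto

lemma map_fst_cong:
  assumes "set rs \<subseteq> {..<m}" "\<And>x. x < m \<Longrightarrow> s x = s' x"
  shows "map s rs = map s' rs"
  using assms by (intro map_cong) auto

definition assign :: "nat \<Rightarrow> nat \<Rightarrow> store \<Rightarrow> store" where
  "assign x v \<sigma> = ((fst \<sigma>)(x := v), snd \<sigma>)"

lemma fst_assign [simp]: "fst (assign x v \<sigma>) = (fst \<sigma>)(x := v)"
  by (simp add: assign_def)

lemma snd_assign [simp]: "snd (assign x v \<sigma>) = snd \<sigma>"
  by (simp add: assign_def)

lemma inc_eq_assign: "inc x \<sigma> = assign x (Suc (fst \<sigma> x)) \<sigma>"
  by (simp add: inc_def assign_def)

lemma dec_eq_assign: "dec x \<sigma> = assign x (fst \<sigma> x - 1) \<sigma>"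
  by (simp add: dec_def assign_def)

lemma store_eqI: "fst \<sigma> = fst \<tau> \<Longrightarrow> snd \<sigma> = snd \<tau> \<Longrightarrow> \<sigma> = \<tau>" for \<sigma> \<tau> :: store
  by (rule prod_eqI)

lemma realizable_clear: "realizable (assign x 0)"
proof -
  have "(dec x ^^ n) \<sigma> = assign x (fst \<sigma> x - n) \<sigma>" for n \<sigma>
    by (induction n) (auto simp: dec_eq_assign intro!: store_eqI)
  then have "(\<lambda>\<sigma>. (dec x ^^ fst \<sigma> x) \<sigma>) = assign x 0"
    by auto
  then show ?thesis
    using realizable_loop[OF realizable_dec, of x x] by (simp add: dec_def)
qed

text \<open>A loop consumes its counter, so the value of \<open>x\<close> is moved to
  \<open>y\<close> and \<open>z\<close> at once and then restored from \<open>z\<close>.\<close>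

lemma realizable_copy:
  assumes "distinct [x, y, z]"
  shows "realizable (\<lambda>\<sigma>. assign z 0 (assign y (fst \<sigma> x) \<sigma>))"
proof -
  define f where "f = (\<lambda>\<sigma>. inc z (inc y (dec x \<sigma>)))"
  define g where "g = (\<lambda>\<sigma>. inc x (dec z \<sigma>))"
  have "realizable f"
    unfolding f_def by (rule realizable_comp[OF realizable_comp[OF realizable_dec realizable_inc] realizable_inc])
  then have loop_f: "realizable (\<lambda>\<sigma>. (f ^^ fst \<sigma> x) \<sigma>)"
    by (rule realizable_loop) (use assms in \<open>simp add: f_def inc_def dec_def\<close>)
  have "realizable g"
    unfolding g_def by (rule realizable_comp[OF realizable_dec realizable_inc])
  then have loop_g: "realizable (\<lambda>\<sigma>. (g ^^ fst \<sigma> z) \<sigma>)"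
    by (rule realizable_loop) (use assms in \<open>simp add: g_def inc_def dec_def\<close>)
  have f: "(f ^^ n) \<sigma> = assign z (fst \<sigma> z + n) (assign y (fst \<sigma> y + n) (assign x (fst \<sigma> x - n) \<sigma>))" for n \<sigma>
    using assms by (induction n) (auto simp: f_def inc_def dec_def assign_def fun_eq_iff)
  have g: "(g ^^ n) \<sigma> = assign x (fst \<sigma> x + n) (assign z (fst \<sigma> z - n) \<sigma>)" for n \<sigma>
    using assms by (induction n) (auto simp: g_def inc_def dec_def assign_def fun_eq_iff)
  let ?h = "\<lambda>\<sigma>. assign z 0 (assign y 0 \<sigma>)"
  let ?f = "\<lambda>\<sigma>. (f ^^ fst (?h \<sigma>) x) (?h \<sigma>)"
  have "(g ^^ fst (?f \<sigma>) z) (?f \<sigma>) = assign z 0 (assign y (fst \<sigma> x) \<sigma>)" for \<sigma>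
    unfolding f g using assms by (auto simp: assign_def fun_eq_iff)
  then show ?thesis
    using realizable_comp[OF realizable_comp[OF realizable_comp[OF realizable_clear[of y] realizable_clear[of z]] loop_f] loop_g]
    by (simp only:)
qed

section \<open>Primitive recursion\<close>

lemma computable_nth:
  assumes "j < l"
  shows "computable l (\<lambda>B v. v ! j)"
proof (rule computableI)
  fix rs :: "nat list" and m :: nat
  assume rs: "length rs = l" "set rs \<subseteq> {..<m}"
  then have "rs ! j < m"
    using assms by (meson lessThan_iff nth_mem subsetD)
  then have "computes m (\<lambda>B v. v ! j) rs (\<lambda>\<sigma>. assign (Suc m) 0 (assign m (fst \<sigma> (rs ! j)) \<sigma>))"
    using rs assms by (auto simp: computes_def intro!: realizable_copy)
  then show "\<exists>F. computes m (\<lambda>B v. v ! j) rs F" by blast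
qed

lemma computable_zero: "computable l (\<lambda>B v. 0)"
proof (rule computableI)
  fix rs :: "nat list" and m :: nat
  have "computes m (\<lambda>B v. 0) rs (assign m 0)"
    by (auto simp: computes_def realizable_clear)
  then show "\<exists>F. computes m (\<lambda>B v. 0) rs F" by blast
qed

lemma computable_Suc:
  assumes "computable l f"
  shows "computable l (\<lambda>B v. Suc (f B v))"
proof (rule computableI)
  fix rs :: "nat list" and m :: nat
  assume "length rs = l" "set rs \<subseteq> {..<m}"
  with assms obtain F where "computes m f rs F"
    by (rule computableE)
  then have "computes m (\<lambda>B v. Suc (f B v)) rs (\<lambda>\<sigma>. inc m (F \<sigma>))"
    using realizable_comp[of F "inc m", OF _ realizable_inc]
    unfolding computes_def inc_eq_assign[of m "F _"] by simp
  then show "\<exists>F. computes m (\<lambda>B v. Suc (f B v)) rs F" by blast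
qed

lemma computable_oracle:
  assumes "computable l f"
  shows "computable l (\<lambda>B v. of_bool (f B v \<in> B))"
proof (rule computableI)
  fix rs :: "nat list" and m :: nat
  assume "length rs = l" "set rs \<subseteq> {..<m}"
  then have "length rs = l" "set rs \<subseteq> {..<Suc m}"
    by auto
  with assms obtain F where F: "computes (Suc m) f rs F"
    by (rule computableE)
  then have "realizable (\<lambda>\<sigma>. inc_if_bit (Suc m) m (assign m 0 (F \<sigma>)))"
    using realizable_comp[OF realizable_comp[OF _ realizable_clear] realizable_inc_if_bit] by (simp add: computes_def)
  then have "computes m (\<lambda>B v. of_bool (f B v \<in> B)) rs (\<lambda>\<sigma>. inc_if_bit (Suc m) m (assign m 0 (F \<sigma>)))"
    using F by (auto simp: computes_def inc_if_bit_def inc_eq_assign)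
  then show "\<exists>F. computes m (\<lambda>B v. of_bool (f B v \<in> B)) rs F" by blast
qed

lemma computable_comp:
  assumes "computable (length fs) h" "\<And>f. f \<in> set fs \<Longrightarrow> computable l f"
  shows "computable l (\<lambda>B v. h B (map (\<lambda>f. f B v) fs))"
proof (rule computableI)
  fix rs :: "nat list" and m :: nat
  assume rs: "length rs = l" "set rs \<subseteq> {..<m}"
  have "\<exists>F. realizable F \<and> (\<forall>\<sigma>. snd (F \<sigma>) = snd \<sigma> \<and> (\<forall>x<k. fst (F \<sigma>) x = fst \<sigma> x) \<and>
      (\<forall>i<length fs. fst (F \<sigma>) (k + i) = (fs ! i) (snd \<sigma>) (map (fst \<sigma>) rs)))" if "m \<le> k" for k
    using assms(2) that
  proof (induction fs arbitrary: k)
    case Nil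
    show ?case
      by (rule exI[of _ "\<lambda>\<sigma>. \<sigma>"]) (simp add: realizable_id)
  next
    case (Cons f fs)
    have "set rs \<subseteq> {..<k}"
      using rs Cons.prems by auto
    then obtain F where F: "computes k f rs F"
      using computableE[of l f rs k] Cons.prems(1) rs by auto
    obtain G where G: "realizable G" "\<And>\<sigma>. snd (G \<sigma>) = snd \<sigma>" "\<And>\<sigma> x. x < Suc k \<Longrightarrow> fst (G \<sigma>) x = fst \<sigma> x"
      "\<And>\<sigma> i. i < length fs \<Longrightarrow> fst (G \<sigma>) (Suc k + i) = (fs ! i) (snd \<sigma>) (map (fst \<sigma>) rs)"
      using Cons.IH[of "Suc k"] Cons.prems by (metis (no_types, lifting) le_SucI list.set_intros(2))
    have args: "map (fst (F \<sigma>)) rs = map (fst \<sigma>) rs" for \<sigma>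
      using F \<open>set rs \<subseteq> {..<k}\<close> by (intro map_fst_cong[of _ k]) (auto simp: computes_def)
    have "fst (G (F \<sigma>)) (k + i) = ((f # fs) ! i) (snd \<sigma>) (map (fst \<sigma>) rs)" if "i < length (f # fs)" for i \<sigma>
      using that G(3)[of k "F \<sigma>"] G(4)[of "i - 1" "F \<sigma>"] F args by (cases i) (auto simp: computes_def)
    then show ?case
      using F G by (intro exI[of _ "\<lambda>\<sigma>. G (F \<sigma>)"]) (auto simp: computes_def intro: realizable_comp)
  qed
  from this[of m] obtain F where F: "realizable F" "\<And>\<sigma>. snd (F \<sigma>) = snd \<sigma>" "\<And>\<sigma> x. x < m \<Longrightarrow> fst (F \<sigma>) x = fst \<sigma> x"
    "\<And>\<sigma> i. i < length fs \<Longrightarrow> fst (F \<sigma>) (m + i) = (fs ! i) (snd \<sigma>) (map (fst \<sigma>) rs)"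
    by auto
  define k where "k = m + length fs"
  have "length [m..<k] = length fs" "set [m..<k] \<subseteq> {..<k}"
    by (auto simp: k_def)
  with assms(1) obtain H where H: "computes k h [m..<k] H"
    by (rule computableE)
  have args: "map (fst (F \<sigma>)) [m..<k] = map (\<lambda>f. f (snd \<sigma>) (map (fst \<sigma>) rs)) fs" for \<sigma>
    by (rule nth_equalityI) (auto simp: k_def F)
  \<comment> \<open>For empty \<open>fs\<close> the result already sits in register
    \<open>m\<close>; the copy would need distinct registers.\<close>
  define G where "G = (\<lambda>\<sigma>. if k = m then \<sigma> else assign (Suc k) 0 (assign m (fst \<sigma> k) \<sigma>))"
  have "realizable G"
    unfolding G_def using realizable_copy[of k m "Suc k"]
    by (cases "k = m") (simp_all add: realizable_id k_def)
  then have "realizable (\<lambda>\<sigma>. G (H (F \<sigma>)))"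
    using F H realizable_comp[OF realizable_comp[of F H], of G] by (simp add: computes_def)
  moreover have "fst (G \<sigma>) m = fst \<sigma> k" "snd (G \<sigma>) = snd \<sigma>" "x < m \<Longrightarrow> fst (G \<sigma>) x = fst \<sigma> x" for \<sigma> x
    by (auto simp: G_def k_def)
  ultimately have "computes m (\<lambda>B v. h B (map (\<lambda>f. f B v) fs)) rs (\<lambda>\<sigma>. G (H (F \<sigma>)))"
    using H F args by (auto simp: computes_def k_def)
  then show "\<exists>F. computes m (\<lambda>B v. h B (map (\<lambda>f. f B v) fs)) rs F" by blast
qed

lemma computable_rec_nat:
  assumes "computable l f" "computable l a" "computable (Suc (Suc l)) (\<lambda>B v. g B (v ! 0) (v ! 1) (tl (tl v)))"
  shows "computable l (\<lambda>B v. rec_nat (a B v) (\<lambda>i y. g B i y v) (f B v))"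
proof (rule computableI)
  fix rs :: "nat list" and m :: nat
  assume rs: "length rs = l" "set rs \<subseteq> {..<m}"
  then have "set rs \<subseteq> {..<Suc m}" "set (Suc (Suc m) # m # rs) \<subseteq> {..<Suc (Suc (Suc m))}"
    by auto
  obtain A where A: "computes m a rs A"
    using assms(2) rs by (rule computableE)
  obtain F where F: "computes (Suc m) f rs F"
    using assms(1) rs(1) \<open>set rs \<subseteq> {..<Suc m}\<close> by (rule computableE)
  obtain G where G: "computes (Suc (Suc (Suc m))) (\<lambda>B v. g B (v ! 0) (v ! 1) (tl (tl v))) (Suc (Suc m) # m # rs) G"
    using assms(3) _ \<open>set (Suc (Suc m) # m # rs) \<subseteq> _\<close> by (rule computableE) (simp add: rs)
  \<comment> \<open>Register \<open>m\<close> holds the accumulated value, \<open>m + 1\<close> the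
    number of remaining rounds, \<open>m + 2\<close> the index, \<open>m + 3\<close> the next value,
    and \<open>m + 4\<close> is scratch space for the copy.\<close>
  define copy where "copy = (\<lambda>\<sigma>. assign (m + 4) 0 (assign m (fst \<sigma> (m + 3)) \<sigma>))"
  define body where "body = (\<lambda>\<sigma>. dec (m + 1) (inc (m + 2) (copy (G \<sigma>))))"
  define init where "init = (\<lambda>\<sigma>. assign (m + 2) 0 (F (A \<sigma>)))"
  have "realizable copy"
    unfolding copy_def by (intro realizable_copy) auto
  then have "realizable body"
    unfolding body_def using G realizable_comp[OF realizable_comp[OF realizable_comp[of G copy] realizable_inc] realizable_dec]
    by (simp add: computes_def)
  moreover have G': "fst (G \<sigma>) x = fst \<sigma> x" if "x < m + 3" for x \<sigma>
    using G that by (simp add: computes_def numeral_3_eq_3)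
  then have body: "fst (body \<sigma>) m = g (snd \<sigma>) (fst \<sigma> (m + 2)) (fst \<sigma> m) (map (fst \<sigma>) rs)"
    "snd (body \<sigma>) = snd \<sigma>" "fst (body \<sigma>) (m + 1) = fst \<sigma> (m + 1) - 1"
    "fst (body \<sigma>) (m + 2) = Suc (fst \<sigma> (m + 2))" "x < m \<Longrightarrow> fst (body \<sigma>) x = fst \<sigma> x" for \<sigma> x
    using G by (auto simp: body_def copy_def computes_def inc_def dec_def numeral_3_eq_3)
  ultimately have "realizable (\<lambda>\<sigma>. (body ^^ fst \<sigma> (m + 1)) \<sigma>)"
    using realizable_loop[of body "m + 1"] by blast
  moreover have "realizable init"
    unfolding init_def using A F realizable_comp[OF realizable_comp[of A F] realizable_clear]
    by (simp add: computes_def)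
  ultimately have "realizable (\<lambda>\<sigma>. (body ^^ fst (init \<sigma>) (m + 1)) (init \<sigma>))"
    using realizable_comp[of init] by simp
  moreover have "snd ((body ^^ n) \<sigma>) = snd \<sigma> \<and> (\<forall>x<m. fst ((body ^^ n) \<sigma>) x = fst \<sigma> x) \<and>
      fst ((body ^^ n) \<sigma>) (m + 2) = fst \<sigma> (m + 2) + n" for n \<sigma>
    by (induction n) (auto simp: body[simplified])
  note loop = this
  have result: "fst ((body ^^ n) \<sigma>) m = rec_nat (fst \<sigma> m) (\<lambda>i y. g (snd \<sigma>) i y (map (fst \<sigma>) rs)) n"
    if "fst \<sigma> (m + 2) = 0" for n \<sigma>
  proof (induction n)
    case (Suc n)
    have "map (fst ((body ^^ n) \<sigma>)) rs = map (fst \<sigma>) rs"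
      using loop rs(2) by (intro map_fst_cong[of _ m]) auto
    then show ?case
      using Suc that loop[of n \<sigma>] by (simp add: body[simplified] del: map_eq_conv)
  qed simp
  have args: "map (fst (A \<sigma>)) rs = map (fst \<sigma>) rs" for \<sigma>
    using A rs(2) by (intro map_fst_cong[of _ m]) (auto simp: computes_def)
  have init: "snd (init \<sigma>) = snd \<sigma>" "fst (init \<sigma>) (m + 2) = 0" "fst (init \<sigma>) m = a (snd \<sigma>) (map (fst \<sigma>) rs)"
    "fst (init \<sigma>) (m + 1) = f (snd \<sigma>) (map (fst \<sigma>) rs)" "x < m \<Longrightarrow> fst (init \<sigma>) x = fst \<sigma> x" for \<sigma> x
    using A F args by (auto simp: init_def computes_def simp del: map_eq_conv)
  have init_args: "map (fst (init \<sigma>)) rs = map (fst \<sigma>) rs" for \<sigma>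
    using init rs(2) by (intro map_fst_cong[of _ m]) auto
  ultimately have "computes m (\<lambda>B v. rec_nat (a B v) (\<lambda>i y. g B i y v) (f B v)) rs
      (\<lambda>\<sigma>. (body ^^ fst (init \<sigma>) (m + 1)) (init \<sigma>))"
    unfolding computes_def using loop by (simp add: result init[simplified] init_args del: map_eq_conv)
  then show "\<exists>F. computes m (\<lambda>B v. rec_nat (a B v) (\<lambda>i y. g B i y v) (f B v)) rs F" by blast
qed

text \<open>Sums and bounded quantifiers prepend their bound variable to the argument list, so the
  surrounding context reappears inside as \<open>tl v\<close>.\<close>

lemma computable_tl:
  assumes "computable l f"
  shows "computable (Suc l) (\<lambda>B v. f B (tl v))"
proof (rule computable_cong)
  let ?fs = "map (\<lambda>i B v. v ! Suc i) [0..<l]"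
  show "computable (Suc l) (\<lambda>B v. f B (map (\<lambda>g. g B v) ?fs))"
    using assms by (intro computable_comp) (auto intro: computable_nth)
  show "f B (map (\<lambda>g. g B v) ?fs) = f B (tl v)" if "length v = Suc l" for B v
    using that by (intro arg_cong[of _ _ "f B"] nth_equalityI) (auto simp: nth_tl)
qed

text \<open>In a recursion the list begins with the index and the accumulated value; the summand of
  a sum ignores the second of them.\<close>

lemma computable_skip:
  assumes "computable (Suc l) (\<lambda>B v. f B (v ! 0) (tl v))"
  shows "computable (Suc (Suc l)) (\<lambda>B v. f B (v ! 0) (tl (tl v)))"
proof (rule computable_cong)
  let ?fs = "(\<lambda>B v. v ! 0) # map (\<lambda>i B v. v ! Suc (Suc i)) [0..<l]"
  show "computable (Suc (Suc l)) (\<lambda>B v. (\<lambda>B v. f B (v ! 0) (tl v)) B (map (\<lambda>g. g B v) ?fs))"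
    using assms by (intro computable_comp) (auto intro: computable_nth)
  show "(\<lambda>B v. f B (v ! 0) (tl v)) B (map (\<lambda>g. g B v) ?fs) = f B (v ! 0) (tl (tl v))"
    if "length v = Suc (Suc l)" for B v
    using that by (auto intro!: arg_cong[of _ _ "f B (v ! 0)"] nth_equalityI simp: nth_tl)
qed

lemma computable_nth_tl: "Suc j < l \<Longrightarrow> computable l (\<lambda>B v. tl v ! j)"
  by (rule computable_cong[OF _ computable_nth[of "Suc j"]]) (auto simp: nth_tl)

lemma computable_nth_tl2: "Suc (Suc j) < l \<Longrightarrow> computable l (\<lambda>B v. tl (tl v) ! j)"
  by (rule computable_cong[OF _ computable_nth[of "Suc (Suc j)"]]) (auto simp: nth_tl)

lemma computable_const: "computable l (\<lambda>B v. c)"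
  by (induction c) (auto intro: computable_zero computable_Suc)

lemma computable_add:
  assumes "computable l f" "computable l g"
  shows "computable l (\<lambda>B v. f B v + g B v)"
proof -
  have eq: "rec_nat a (\<lambda>i y. Suc y) b = a + b" for a b :: nat
    by (induction b) auto
  show ?thesis
    using computable_rec_nat[OF assms(2,1), of "\<lambda>B i y v. Suc y"]
    by (simp add: eq computable_Suc computable_nth)
qed

lemma computable_diff:
  assumes "computable l f" "computable l g"
  shows "computable l (\<lambda>B v. f B v - g B v)"
proof -
  have eq: "rec_nat 0 (\<lambda>i y. i) b = b - 1" for b :: nat
    by (induction b) auto
  have pred: "computable l (\<lambda>B v. h B v - 1)" if "computable l h" for l h
    using computable_rec_nat[OF that computable_zero, of "\<lambda>B i y v. i"]
    by (simp add: eq computable_nth)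
  have eq': "rec_nat a (\<lambda>i y. y - 1) b = a - b" for a b :: nat
    by (induction b) auto
  show ?thesis
    using computable_rec_nat[OF assms(2,1), of "\<lambda>B i y v. y - 1"]
    by (simp only: eq' pred computable_nth)
qed

lemma computable_sum:
  assumes "computable l f" "computable (Suc l) (\<lambda>B v. g B (v ! 0) (tl v))"
  shows "computable l (\<lambda>B v. \<Sum>i<f B v. g B i v)"
proof -
  have eq: "rec_nat 0 (\<lambda>i y. y + h i) n = (\<Sum>i<n. h i)" for h :: "nat \<Rightarrow> nat" and n
    by (induction n) auto
  have "computable (Suc (Suc l)) (\<lambda>B v. v ! 1 + g B (v ! 0) (tl (tl v)))"
    by (rule computable_add[OF computable_nth computable_skip[OF assms(2)]]) simp
  then have "computable l (\<lambda>B v. rec_nat 0 (\<lambda>i y. y + g B i v) (f B v))"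
    by (rule computable_rec_nat[where g = "\<lambda>B i y v. y + g B i v", OF assms(1) computable_zero])
  then show ?thesis
    by (simp add: eq)
qed

lemma computable_mult:
  assumes "computable l f" "computable l g"
  shows "computable l (\<lambda>B v. f B v * g B v)"
proof -
  have "computable l (\<lambda>B v. \<Sum>i<g B v. f B v)"
    by (rule computable_sum[where g = "\<lambda>B i v. f B v", OF assms(2) computable_tl[OF assms(1)]])
  then show ?thesis
    by (simp add: mult.commute)
qed

lemma computable_power:
  assumes "computable l f" "computable l g"
  shows "computable l (\<lambda>B v. f B v ^ g B v)"
proof -
  have eq: "rec_nat 1 (\<lambda>i y. y * a) n = a ^ n" for a n :: nat
    by (induction n) auto
  have "computable (Suc (Suc l)) (\<lambda>B v. v ! 1 * f B (tl (tl v)))"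
    by (rule computable_mult[OF computable_nth computable_tl[OF computable_tl[OF assms(1)]]]) simp
  then have "computable l (\<lambda>B v. rec_nat 1 (\<lambda>i y. y * f B v) (g B v))"
    by (rule computable_rec_nat[where g = "\<lambda>B i y v. y * f B v", OF assms(2) computable_const])
  then show ?thesis
    unfolding eq .
qed

section \<open>Decidable predicates, division and binary digits\<close>

lemma decidable_le:
  assumes "computable l f" "computable l g"
  shows "computable l (\<lambda>B v. of_bool (f B v \<le> g B v))"
proof -
  have "of_bool (a \<le> b) = 1 - (a - b)" for a b :: nat
    by auto
  then show ?thesis
    using computable_diff[OF computable_const[of l 1] computable_diff[OF assms]] by (simp only:)
qed

lemma decidable_not:
  assumes "computable l (\<lambda>B v. of_bool (P B v))"
  shows "computable l (\<lambda>B v. of_bool (\<not> P B v))"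
proof -
  have "of_bool (\<not> Q) = 1 - (of_bool Q :: nat)" for Q
    by simp
  then show ?thesis
    using computable_diff[OF computable_const[of l 1] assms] by (simp only:)
qed

lemma decidable_conj:
  assumes "computable l (\<lambda>B v. of_bool (P B v))" "computable l (\<lambda>B v. of_bool (Q B v))"
  shows "computable l (\<lambda>B v. of_bool (P B v \<and> Q B v))"
  using computable_mult[OF assms] by (simp only: of_bool_conj)

lemma decidable_imp:
  assumes "computable l (\<lambda>B v. of_bool (P B v))" "computable l (\<lambda>B v. of_bool (Q B v))"
  shows "computable l (\<lambda>B v. of_bool (P B v \<longrightarrow> Q B v))"
  using decidable_not[OF decidable_conj[OF assms(1) decidable_not[OF assms(2)]]] by simp

lemma decidable_iff:
  assumes "computable l (\<lambda>B v. of_bool (P B v))" "computable l (\<lambda>B v. of_bool (Q B v))"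
  shows "computable l (\<lambda>B v. of_bool (P B v \<longleftrightarrow> Q B v))"
  using decidable_conj[OF decidable_imp[OF assms] decidable_imp[OF assms(2,1)]]
  by (simp only: iff_conv_conj_imp)

lemma decidable_less:
  assumes "computable l f" "computable l g"
  shows "computable l (\<lambda>B v. of_bool (f B v < g B v))"
  using decidable_not[OF decidable_le[OF assms(2,1)]] by (simp only: not_le)

lemma decidable_eq:
  assumes "computable l f" "computable l g"
  shows "computable l (\<lambda>B v. of_bool (f B v = g B v))"
  using decidable_conj[OF decidable_le[OF assms] decidable_le[OF assms(2,1)]]
  by (simp only: order_eq_iff)

lemma decidable_ex:
  assumes "computable l f" "computable (Suc l) (\<lambda>B v. of_bool (P B (v ! 0) (tl v)))"
  shows "computable l (\<lambda>B v. of_bool (\<exists>i<f B v. P B i v))"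
proof -
  have "computable l (\<lambda>B v. of_bool (0 < (\<Sum>i<f B v. of_bool (P B i v) :: nat)))"
    by (rule decidable_less[OF computable_zero computable_sum[where g = "\<lambda>B i v. of_bool (P B i v)", OF assms]])
  moreover have "0 < (\<Sum>i<n. of_bool (Q i) :: nat) \<longleftrightarrow> (\<exists>i<n. Q i)" for Q and n :: nat
    using sum_eq_0_iff[OF finite_lessThan, of "\<lambda>i. of_bool (Q i) :: nat" n]
    by (auto simp del: sum_eq_0_iff sum_of_bool_eq)
  ultimately show ?thesis
    by (simp only:)
qed

lemma decidable_all:
  assumes "computable l f" "computable (Suc l) (\<lambda>B v. of_bool (P B (v ! 0) (tl v)))"
  shows "computable l (\<lambda>B v. of_bool (\<forall>i<f B v. P B i v))"
  using decidable_not[OF decidable_ex[OF assms(1), where P = "\<lambda>B i v. \<not> P B i v"], OF decidable_not[OF assms(2)]]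
  by simp

lemma computable_div:
  assumes "computable l f" "computable l g"
  shows "computable l (\<lambda>B v. f B v div g B v)"
proof -
  \<comment> \<open>The quotient counts the positive multiples of the divisor up to the dividend.
    For divisor 0 the count would be the dividend; the factor \<open>of_bool\<close> restores the
    value 0.\<close>
  have "computable (Suc l) (\<lambda>B v. of_bool (Suc (v ! 0) * g B (tl v) \<le> f B (tl v)))"
    by (rule decidable_le[OF computable_mult[OF computable_Suc[OF computable_nth] computable_tl[OF assms(2)]]
          computable_tl[OF assms(1)]]) simp
  then have "computable l (\<lambda>B v. of_bool (0 < g B v) * (\<Sum>i<f B v. of_bool (Suc i * g B v \<le> f B v)))"
    by (rule computable_mult[OF decidable_less[OF computable_zero assms(2)]
          computable_sum[where g = "\<lambda>B i v. of_bool (Suc i * g B v \<le> f B v)", OF assms(1)]])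
  moreover have "of_bool (0 < b) * (\<Sum>i<a. of_bool (Suc i * b \<le> a)) = a div b" for a b :: nat
  proof (cases "b = 0")
    case False
    have "{i \<in> {..<a}. Suc i * b \<le> a} = {..<a div b}"
    proof (intro equalityI subsetI)
      fix i
      assume "i \<in> {..<a div b}"
      then have "Suc i \<le> a div b" "i < a"
        using div_le_dividend[of a b] by (auto intro: less_le_trans simp del: div_le_dividend)
      then show "i \<in> {i \<in> {..<a}. Suc i * b \<le> a}"
        using False by (simp add: less_eq_div_iff_mult_less_eq)
    qed (use False in \<open>auto simp: Suc_le_eq[symmetric] less_eq_div_iff_mult_less_eq\<close>)
    moreover have "(\<Sum>i<a. of_bool (Suc i * b \<le> a)) = card {i \<in> {..<a}. Suc i * b \<le> a}"
      by (subst sum_of_bool_eq) (auto intro!: arg_cong[of _ _ card])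
    ultimately show ?thesis
      using False by simp
  qed simp
  ultimately show ?thesis
    by (simp only:)
qed

lemma computable_mod:
  assumes "computable l f" "computable l g"
  shows "computable l (\<lambda>B v. f B v mod g B v)"
  using computable_diff[OF assms(1) computable_mult[OF assms(2) computable_div[OF assms]]]
  by (simp add: minus_mult_div_eq_mod)

lemma decidable_bit:
  assumes "computable l f" "computable l g"
  shows "computable l (\<lambda>B v. of_bool (bit (f B v) (g B v)))"
proof -
  have "of_bool (bit a b) = (a div 2 ^ b) mod 2" for a b :: nat
    by (simp add: bit_iff_odd mod2_eq_if)
  then show ?thesis
    using computable_mod[OF computable_div[OF assms(1) computable_power[OF computable_const[of l 2] assms(2)]]
        computable_const[of l 2]] by (simp only:)
qed

text \<open>A named function is treated once on a list of variables; composition then admits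
  arbitrary computable arguments, also below bound variables.\<close>

lemma computable_comp2:
  assumes "computable 2 (\<lambda>B v. h (v ! 0) (v ! 1))" "computable l f" "computable l g"
  shows "computable l (\<lambda>B v. h (f B v) (g B v))"
  using computable_comp[of "[f, g]" "\<lambda>B v. h (v ! 0) (v ! 1)" l] assms by (auto simp: numeral_eq_Suc)

lemma computable_comp3:
  assumes "computable 3 (\<lambda>B v. h (v ! 0) (v ! 1) (v ! 2))" "computable l f" "computable l g" "computable l f'"
  shows "computable l (\<lambda>B v. h (f B v) (g B v) (f' B v))"
  using computable_comp[of "[f, g, f']" "\<lambda>B v. h (v ! 0) (v ! 1) (v ! 2)" l] assms by (auto simp: numeral_eq_Suc)

lemma computable_comp4:
  assumes "computable 4 (\<lambda>B v. h (v ! 0) (v ! 1) (v ! 2) (v ! 3))"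
    "computable l f" "computable l g" "computable l f'" "computable l g'"
  shows "computable l (\<lambda>B v. h (f B v) (g B v) (f' B v) (g' B v))"
  using computable_comp[of "[f, g, f', g']" "\<lambda>B v. h (v ! 0) (v ! 1) (v ! 2) (v ! 3)" l] assms by (auto simp: numeral_eq_Suc)

lemma computable_comp5:
  assumes "computable 5 (\<lambda>B v. h (v ! 0) (v ! 1) (v ! 2) (v ! 3) (v ! 4))"
    "computable l f" "computable l g" "computable l f'" "computable l g'" "computable l f''"
  shows "computable l (\<lambda>B v. h (f B v) (g B v) (f' B v) (g' B v) (f'' B v))"
  using computable_comp[of "[f, g, f', g', f'']" "\<lambda>B v. h (v ! 0) (v ! 1) (v ! 2) (v ! 3) (v ! 4)" l] assms
  by (auto simp: numeral_eq_Suc)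

lemmas computable_intros =
  computable_const computable_nth computable_nth_tl computable_nth_tl2 computable_Suc computable_add computable_diff
  computable_mult computable_power computable_div computable_mod computable_sum computable_oracle decidable_le decidable_less
  decidable_eq decidable_not decidable_conj decidable_imp decidable_iff decidable_ex decidable_all decidable_bit

text \<open>The output overwrites the input on track 1. Hence its length and a number having it as
  binary digits are both computed before the first bit is written; the writing loop consults
  registers only.\<close>

lemma computable_imp_tm_fun:
  assumes "computable 1 (\<lambda>B v. len B (v ! 0))" "computable 1 (\<lambda>B v. code B (v ! 0))"
  shows "\<exists>M. turing_machine M \<and> (\<forall>w. tm_fun M w =
    (let B = {j. j < length w \<and> w ! j} in
     Some (map (bit (code B (length w))) [0..<len B (length w)])))"
proof -
  txt \<open>Register 0 holds the length of the input, 1 the code, 2 the length of the output, 3 the next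
    position, 4 the number of remaining positions and 5 the bit to be written.\<close>
  obtain G where G: "computes 1 (\<lambda>B v. code B (v ! 0)) [0] G"
    using assms(2) by (rule computableE) auto
  obtain L where L: "computes 2 (\<lambda>B v. len B (v ! 0)) [0] L"
    using assms(1) by (rule computableE) auto
  have "computable 2 (\<lambda>B v. of_bool (bit (v ! 0) (v ! 1)))"
    by (intro computable_intros) auto
  then obtain H where H: "computes 5 (\<lambda>B v. of_bool (bit (v ! 0) (v ! 1))) [1, 3] H"
    by (rule computableE) auto
  define body where "body = (\<lambda>\<sigma>. dec 4 (inc 3 (put_bit 3 5 (H \<sigma>))))"
  define init where "init = (\<lambda>\<sigma>. (\<lambda>\<sigma>. assign 5 0 (assign 4 (fst \<sigma> 2) \<sigma>)) (assign 3 0 (L (G \<sigma>))))"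
  have "realizable G" "realizable L" "realizable H"
    using G L H by (auto simp: computes_def)
  then have "realizable (\<lambda>\<sigma>. assign 3 0 (L (G \<sigma>)))" "realizable (\<lambda>\<sigma>. inc 3 (put_bit 3 5 (H \<sigma>)))"
    using realizable_comp[OF realizable_comp[of G L] realizable_clear[of 3]]
      realizable_comp[OF realizable_comp[of H, OF _ realizable_put_bit[of 3 5]] realizable_inc[of 3]] by simp_all
  then have "realizable init" "realizable body"
    unfolding init_def body_def
    using realizable_comp[of "\<lambda>\<sigma>. assign 3 0 (L (G \<sigma>))", OF _ realizable_copy[of 2 4 5]]
      realizable_comp[of "\<lambda>\<sigma>. inc 3 (put_bit 3 5 (H \<sigma>))", OF _ realizable_dec[of 4]] by simp_all
  have body: "fst (body \<sigma>) 1 = fst \<sigma> 1" "fst (body \<sigma>) 2 = fst \<sigma> 2" "fst (body \<sigma>) 3 = Suc (fst \<sigma> 3)"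
    "fst (body \<sigma>) 4 = fst \<sigma> 4 - 1"
    "snd (body \<sigma>) = (if bit (fst \<sigma> 1) (fst \<sigma> 3) then insert (fst \<sigma> 3) (snd \<sigma>) else snd \<sigma> - {fst \<sigma> 3})" for \<sigma>
    using H by (auto simp: computes_def body_def dec_def inc_def put_bit_def)
  define F where "F = (\<lambda>\<sigma>. (body ^^ fst (init \<sigma>) 4) (init \<sigma>))"
  have "realizable (\<lambda>\<sigma>. (body ^^ fst \<sigma> 4) \<sigma>)"
    using \<open>realizable body\<close> body(4) by (rule realizable_loop)
  with \<open>realizable init\<close> have "realizable F"
    unfolding F_def by (rule realizable_comp[of init])
  then obtain M where M: "turing_machine M"
    "\<And>w. tm_fun M w = Some (map (\<lambda>j. j \<in> snd (F (store_of w))) [0..<fst (F (store_of w)) 2])"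
    using realizable_imp_tm_fun by blast
  have loop: "fst ((body ^^ n) \<sigma>) 1 = fst \<sigma> 1 \<and> fst ((body ^^ n) \<sigma>) 2 = fst \<sigma> 2 \<and> fst ((body ^^ n) \<sigma>) 3 = n \<and>
    (\<forall>j<n. j \<in> snd ((body ^^ n) \<sigma>) \<longleftrightarrow> bit (fst \<sigma> 1) j)" if "fst \<sigma> 3 = 0" for n \<sigma>
    by (induction n) (use that in \<open>auto simp: body[simplified] less_Suc_eq\<close>)
  have "tm_fun M w = (let B = {j. j < length w \<and> w ! j} in
     Some (map (bit (code B (length w))) [0..<len B (length w)]))" for w
  proof -
    let ?B = "{j. j < length w \<and> w ! j}"
    have init: "fst (init (store_of w)) 1 = code ?B (length w)" "fst (init (store_of w)) 2 = len ?B (length w)"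
      "fst (init (store_of w)) 3 = 0" "fst (init (store_of w)) 4 = len ?B (length w)"
      using G L by (auto simp: init_def computes_def store_of_def)
    have "fst (F (store_of w)) 2 = len ?B (length w)"
      using loop[of "init (store_of w)"] init by (simp add: F_def)
    moreover have "j \<in> snd (F (store_of w)) \<longleftrightarrow> bit (code ?B (length w)) j" if "j < len ?B (length w)" for j
      using loop[of "init (store_of w)" "len ?B (length w)"] init that by (simp add: F_def)
    ultimately show ?thesis
      by (simp add: M(2) Let_def)
  qed
  with M(1) show ?thesis
    by blast
qed

section \<open>Atypical graphs\<close>

text \<open>The binomial coefficient \<open>n choose 2\<close>, in a form to which the rules for
  computable functions apply.\<close>

definition pairs :: "nat \<Rightarrow> nat" where
  "pairs n = (\<Sum>i<n. i)"

text \<open>For \<open>1 \<le> i < j \<le> n\<close>, the position of the edge \<open>{i, j}\<close> in the lexicographic order, counted from 0.\<close>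

definition edge_index :: "nat \<Rightarrow> nat \<Rightarrow> nat \<Rightarrow> nat" where
  "edge_index n i j = (\<Sum>u<i - 1. n - Suc u) + (j - Suc i)"

text \<open>A subset of \<open>{1..n}\<close> is coded by the number \<open>s < 2 ^ Suc n\<close> whose binary digits, starting with
  the digit 0 for the unused node 0, are its characteristic sequence.\<close>

definition mask_rank :: "nat \<Rightarrow> nat \<Rightarrow> nat" where
  "mask_rank s v = (\<Sum>u<Suc v. of_bool (bit s u))"

definition mask :: "nat \<Rightarrow> nat \<Rightarrow> nat \<Rightarrow> bool" where
  "mask n k s \<longleftrightarrow> \<not> bit s 0 \<and> mask_rank s n = k"

definition occurrence_code :: "nat \<Rightarrow> nat \<Rightarrow> nat \<Rightarrow> nat \<Rightarrow> nat \<Rightarrow> bool" where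
  "occurrence_code n k e g s \<longleftrightarrow> (\<forall>i<Suc n. \<forall>j<Suc n. i < j \<and> bit s i \<and> bit s j \<longrightarrow>
     (bit g (edge_index n i j) \<longleftrightarrow> bit e (edge_index k (mask_rank s i) (mask_rank s j))))"

definition occurrences_code :: "nat \<Rightarrow> nat \<Rightarrow> nat \<Rightarrow> nat \<Rightarrow> nat" where
  "occurrences_code n k e g = (\<Sum>s<2 ^ Suc n. of_bool (mask n k s \<and> occurrence_code n k e g s))"

definition masks :: "nat \<Rightarrow> nat \<Rightarrow> nat" where
  "masks n k = (\<Sum>s<2 ^ Suc n. of_bool (mask n k s))"

text \<open>Scaled by \<open>2 ^ (k choose 2)\<close> to stay within the natural numbers; one of the two truncated
  differences is 0.\<close>

definition deviation :: "nat \<Rightarrow> nat \<Rightarrow> nat \<Rightarrow> nat \<Rightarrow> nat" where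
  "deviation n k e g = (2 ^ pairs k * occurrences_code n k e g - masks n k) +
     (masks n k - 2 ^ pairs k * occurrences_code n k e g)"

definition deviation_rank :: "nat \<Rightarrow> nat \<Rightarrow> nat \<Rightarrow> nat \<Rightarrow> nat" where
  "deviation_rank n k e g = (\<Sum>h<2 ^ pairs n. of_bool (deviation n k e g \<le> deviation n k e h))"

text \<open>The weights \<open>2 ^ - (k * k div 2)\<close> are summable over all graphs on \<open>k\<close> nodes, for all \<open>k\<close>
  together, and are at least \<open>1 / n\<close> in the range of the theorem.\<close>

definition atypical :: "nat \<Rightarrow> nat \<Rightarrow> nat \<Rightarrow> bool" where
  "atypical n r g \<longleftrightarrow> (\<exists>k<Suc n. \<exists>e<2 ^ pairs k.
     deviation_rank n k e g * 2 ^ (r + k * k div 2) \<le> 2 ^ pairs n)"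

text \<open>The atypical number with exactly \<open>i\<close> atypical predecessors, if there is
  one. A bounded sum replaces the search: the summand is 1 exactly for the numbers below it.\<close>

definition nth_atypical :: "nat \<Rightarrow> nat \<Rightarrow> nat \<Rightarrow> nat" where
  "nth_atypical n r i = (\<Sum>g<2 ^ pairs n. of_bool ((\<Sum>h<Suc g. of_bool (atypical n r h)) \<le> i))"

lemma computable_pairs: "computable l f \<Longrightarrow> computable l (\<lambda>B v. pairs (f B v))"
  unfolding pairs_def by (intro computable_intros) auto

lemma computable_edge_index:
  "computable l f \<Longrightarrow> computable l g \<Longrightarrow> computable l h \<Longrightarrow>
    computable l (\<lambda>B v. edge_index (f B v) (g B v) (h B v))"
  by (rule computable_comp3) (unfold edge_index_def, (intro computable_intros; simp)+)

lemma computable_mask_rank: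
  "computable l f \<Longrightarrow> computable l g \<Longrightarrow> computable l (\<lambda>B v. mask_rank (f B v) (g B v))"
  by (rule computable_comp2) (unfold mask_rank_def, (intro computable_intros; simp)+)

lemma decidable_mask:
  "computable l f \<Longrightarrow> computable l g \<Longrightarrow> computable l h \<Longrightarrow>
    computable l (\<lambda>B v. of_bool (mask (f B v) (g B v) (h B v)))"
  by (rule computable_comp3[where h = "\<lambda>n k s. of_bool (mask n k s)"])
    (unfold mask_def, (intro computable_intros computable_mask_rank; simp)+)

lemma decidable_occurrence_code:
  "computable l f \<Longrightarrow> computable l g \<Longrightarrow> computable l f' \<Longrightarrow> computable l g' \<Longrightarrow> computable l f'' \<Longrightarrow>
    computable l (\<lambda>B v. of_bool (occurrence_code (f B v) (g B v) (f' B v) (g' B v) (f'' B v)))"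
  by (rule computable_comp5[where h = "\<lambda>n k e g s. of_bool (occurrence_code n k e g s)"])
    (unfold occurrence_code_def, (intro computable_intros computable_mask_rank computable_edge_index; simp)+)

lemma computable_occurrences_code:
  "computable l f \<Longrightarrow> computable l g \<Longrightarrow> computable l f' \<Longrightarrow> computable l g' \<Longrightarrow>
    computable l (\<lambda>B v. occurrences_code (f B v) (g B v) (f' B v) (g' B v))"
  by (rule computable_comp4)
    (unfold occurrences_code_def, (intro computable_intros decidable_mask decidable_occurrence_code; simp)+)

lemma computable_masks:
  "computable l f \<Longrightarrow> computable l g \<Longrightarrow> computable l (\<lambda>B v. masks (f B v) (g B v))"
  by (rule computable_comp2) (unfold masks_def, (intro computable_intros decidable_mask; simp)+)

lemma computable_deviation:
  "computable l f \<Longrightarrow> computable l g \<Longrightarrow> computable l f' \<Longrightarrow> computable l g' \<Longrightarrow>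
    computable l (\<lambda>B v. deviation (f B v) (g B v) (f' B v) (g' B v))"
  unfolding deviation_def
  by (intro computable_intros computable_pairs computable_masks computable_occurrences_code)

lemma computable_deviation_rank:
  "computable l f \<Longrightarrow> computable l g \<Longrightarrow> computable l f' \<Longrightarrow> computable l g' \<Longrightarrow>
    computable l (\<lambda>B v. deviation_rank (f B v) (g B v) (f' B v) (g' B v))"
  by (rule computable_comp4)
    (unfold deviation_rank_def, (intro computable_intros computable_pairs computable_deviation; simp)+)

lemma decidable_atypical:
  "computable l f \<Longrightarrow> computable l g \<Longrightarrow> computable l h \<Longrightarrow>
    computable l (\<lambda>B v. of_bool (atypical (f B v) (g B v) (h B v)))"
  by (rule computable_comp3[where h = "\<lambda>n r g. of_bool (atypical n r g)"])
    (unfold atypical_def, (intro computable_intros computable_pairs computable_deviation_rank; simp)+)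

lemma computable_nth_atypical:
  "computable l f \<Longrightarrow> computable l g \<Longrightarrow> computable l h \<Longrightarrow>
    computable l (\<lambda>B v. nth_atypical (f B v) (g B v) (h B v))"
  by (rule computable_comp3)
    (unfold nth_atypical_def, (intro computable_intros computable_pairs decidable_atypical; simp)+)

section \<open>Decoding the input \<open>1^l(p) 0 p y\<close>\<close>

definition program_length :: "nat set \<Rightarrow> nat \<Rightarrow> nat" where
  "program_length B l = (\<Sum>i<l. of_bool (\<forall>j<Suc i. j \<in> B))"

definition program_value :: "nat set \<Rightarrow> nat \<Rightarrow> nat" where
  "program_value B l = (\<Sum>i<program_length B l. of_bool (Suc (program_length B l) + i \<in> B) * 2 ^ i)"

text \<open>Inverse of \<open>str\<close> by Horner's scheme: length-lexicographic strings are the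
  base-2 numerals with digits 1 and 2 instead of 0 and 1.\<close>

definition condition_value :: "nat set \<Rightarrow> nat \<Rightarrow> nat" where
  "condition_value B l = rec_nat 0 (\<lambda>i y. 2 * y + (1 + of_bool (Suc (2 * program_length B l) + i \<in> B)))
     (l - Suc (2 * program_length B l))"

lemma computable_comp1:
  assumes "computable 1 (\<lambda>B v. h B (v ! 0))" "computable l f"
  shows "computable l (\<lambda>B v. h B (f B v))"
  using computable_comp[of "[f]" "\<lambda>B v. h B (v ! 0)" l] assms by simp

lemma computable_program_length: "computable l f \<Longrightarrow> computable l (\<lambda>B v. program_length B (f B v))"
  by (rule computable_comp1) (unfold program_length_def, (intro computable_intros; simp)+)

lemma computable_program_value: "computable l f \<Longrightarrow> computable l (\<lambda>B v. program_value B (f B v))"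
  by (rule computable_comp1) (unfold program_value_def, (intro computable_intros computable_program_length; simp)+)

lemma computable_condition_value: "computable l f \<Longrightarrow> computable l (\<lambda>B v. condition_value B (f B v))"
proof (rule computable_comp1[where h = condition_value])
  show "computable 1 (\<lambda>B v. condition_value B (v ! 0))"
    unfolding condition_value_def
    by (intro computable_rec_nat[where g = "\<lambda>B i y v. 2 * y + (1 + of_bool (Suc (2 * program_length B (v ! 0)) + i \<in> B))"]
        computable_intros computable_program_length) auto
qed

lemma rec_nat_cong: "(\<And>i y. i < n \<Longrightarrow> f i y = g i y) \<Longrightarrow> rec_nat a f n = rec_nat a g n"
  by (induction n) auto

lemma rec_nat_str: "rec_nat 0 (\<lambda>i y. 2 * y + (1 + of_bool (str n ! i))) (length (str n)) = n"
proof (induction n rule: str.induct)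
  case (2 n)
  have "rec_nat (0 :: nat) (\<lambda>i y. 2 * y + (1 + of_bool (str (Suc n) ! i))) (length (str (n div 2)))
      = rec_nat 0 (\<lambda>i y. 2 * y + (1 + of_bool (str (n div 2) ! i))) (length (str (n div 2)))"
    by (rule rec_nat_cong) (simp add: nth_append)
  then show ?case
    using 2 by (simp add: nth_append)
qed simp

context
  fixes p y :: bits and B :: "nat set"
  defines "B \<equiv> {j. j < length (pair p y) \<and> pair p y ! j}"
begin

lemma bits_of_pair:
  "j < length p \<Longrightarrow> j \<in> B" "length p \<notin> B"
  "j < length p \<Longrightarrow> Suc (length p + j) \<in> B \<longleftrightarrow> p ! j"
  "j < length y \<Longrightarrow> Suc (2 * length p + j) \<in> B \<longleftrightarrow> y ! j"
  by (auto simp: B_def pair_def nth_append)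

lemma program_length_pair: "program_length B (length (pair p y)) = length p"
proof -
  have "(\<forall>j<Suc i. j \<in> B) \<longleftrightarrow> i < length p" for i
  proof
    assume *: "\<forall>j<Suc i. j \<in> B"
    show "i < length p"
      using *[rule_format, of "length p"] bits_of_pair(2) by (cases "i < length p") auto
  qed (auto intro: bits_of_pair(1))
  moreover have "{..<length (pair p y)} \<inter> {i. i < length p} = {..<length p}"
    by (auto simp: pair_def)
  ultimately show ?thesis
    by (simp add: program_length_def)
qed

lemma program_value_pair: "program_value B (length (pair p y)) = (\<Sum>i<length p. of_bool (p ! i) * 2 ^ i)"
  unfolding program_value_def program_length_pair
  by (intro sum.cong) (auto simp: bits_of_pair)

lemma condition_value_pair:
  assumes "y = str n"
  shows "condition_value B (length (pair p y)) = n"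
proof -
  have "length (pair p y) - Suc (2 * length p) = length y"
    by (simp add: pair_def)
  moreover have "rec_nat (0 :: nat) (\<lambda>i y. 2 * y + (1 + of_bool (Suc (2 * length p) + i \<in> B))) (length y)
      = rec_nat 0 (\<lambda>i z. 2 * z + (1 + of_bool (y ! i))) (length y)"
    by (rule rec_nat_cong) (simp add: bits_of_pair)
  ultimately show ?thesis
    unfolding condition_value_def program_length_pair using rec_nat_str[of n] by (simp add: assms)
qed

end

text \<open>The level \<open>r\<close> costs no bits: it is determined by the length of the program.\<close>

lemma atypical_machine:
  "\<exists>M. turing_machine M \<and> (\<forall>p n. tm_fun M (pair p (str n)) =
     Some (map (bit (nth_atypical n (pairs n + 2 - length p) (\<Sum>i<length p. of_bool (p ! i) * 2 ^ i))) [0..<pairs n]))"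
proof -
  let ?len = "\<lambda>B l. pairs (condition_value B l)"
  let ?code = "\<lambda>B l. nth_atypical (condition_value B l)
    (pairs (condition_value B l) + 2 - program_length B l) (program_value B l)"
  have "computable 1 (\<lambda>B v. ?len B (v ! 0))"
    by (intro computable_intros computable_pairs computable_condition_value) simp
  moreover have "computable 1 (\<lambda>B v. ?code B (v ! 0))"
    by (intro computable_intros computable_pairs computable_condition_value computable_nth_atypical
        computable_program_length computable_program_value) auto
  ultimately obtain M where "turing_machine M" and M: "\<And>w. tm_fun M w =
    (let B = {j. j < length w \<and> w ! j} in
     Some (map (bit (?code B (length w))) [0..<?len B (length w)]))"
    using computable_imp_tm_fun[where len = ?len and code = ?code] by blast
  then show ?thesis
    by (intro exI[of _ M]) (simp add: M Let_def program_length_pair program_value_pair condition_value_pair)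
qed

section \<open>Counting atypical graphs and bounding their complexity\<close>

lemma universal_simulates:
  assumes "universal_for P U" "P M"
  shows "\<exists>c. \<forall>p x y. tm_fun M (pair p y) = Some x \<longrightarrow> complexity U x y \<le> length p + c"
proof -
  obtain T where T: "\<forall>M. P M \<longrightarrow> (\<exists>i. \<forall>p y. tm_fun (T i) (pair p y) = tm_fun M (pair p y))"
    "\<forall>i p y. tm_fun U (pair (pair (str i) p) y) = tm_fun (T i) (pair p y)"
    using assms(1) unfolding universal_for_def by blast
  then obtain i where i: "\<forall>p y. tm_fun (T i) (pair p y) = tm_fun M (pair p y)"
    using assms(2) by blast
  \<comment> \<open>The constant is the length of the self-delimiting header that
    \<open>pair\<close> puts before \<open>p\<close>.\<close>
  have "complexity U x y \<le> length p + (2 * length (str i) + 1)" if "tm_fun M (pair p y) = Some x" for p x y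
  proof -
    have "tm_fun U (pair (pair (str i) p) y) = Some x"
      using that i T(2) by simp
    moreover have "length (pair (str i) p) = length p + (2 * length (str i) + 1)"
      by (simp add: pair_def)
    ultimately show ?thesis
      unfolding complexity_def by (intro Least_le) blast
  qed
  then show ?thesis
    by blast
qed

text \<open>The number of elements up to \<open>g'\<close> stays within the number of predecessors
  of \<open>g\<close> until \<open>g\<close> itself is counted.\<close>

lemma count_enumeration:
  fixes P :: "nat \<Rightarrow> bool"
  assumes "P g" "g < N"
  shows "(\<Sum>g'<N. of_bool ((\<Sum>h<Suc g'. of_bool (P h)) \<le> card {h. h < g \<and> P h})) = g"
proof -
  define c where "c x = card {h. h < x \<and> P h}" for x
  have sum: "(\<Sum>h<x. of_bool (P h)) = c x" for x
  proof -
    have "{..<x} \<inter> {h. P h} = {h. h < x \<and> P h}"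
      by auto
    then show ?thesis
      by (simp add: c_def)
  qed
  have mono: "c x \<le> c y" if "x \<le> y" for x y
    unfolding c_def using that by (intro card_mono) auto
  have "c (Suc g) = Suc (c g)"
    using assms(1) by (simp flip: sum)
  then have "c (Suc x) \<le> c g \<longleftrightarrow> x < g" for x
    using mono[of "Suc x" g] mono[of "Suc g" "Suc x"] by (cases "x < g") auto
  moreover have "{..<N} \<inter> {x. x < g} = {..<g}"
    using assms(2) by auto
  ultimately show ?thesis
    unfolding sum by (simp flip: c_def)
qed

text \<open>Among the elements of low rank take one with the least value of \<open>f\<close>. All
  the others lie in its upper set, whose size is its own rank.\<close>

lemma card_low_rank:
  fixes f :: "'a \<Rightarrow> nat"
  assumes "finite A"
  shows "card {x \<in> A. card {y \<in> A. f x \<le> f y} * c \<le> N} * c \<le> N"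
proof -
  define S where "S = {x \<in> A. card {y \<in> A. f x \<le> f y} * c \<le> N}"
  have "finite S"
    using assms by (simp add: S_def)
  have "card S * c \<le> N"
  proof (cases "S = {}")
    case False
    then obtain m where m: "m \<in> S" "\<And>y. y \<in> S \<Longrightarrow> f m \<le> f y"
      using arg_min_if_finite(1)[of S f] arg_min_least[of S _ f] \<open>finite S\<close> by metis
    have "S \<subseteq> {y \<in> A. f m \<le> f y}"
      using m(2) by (auto simp: S_def)
    then have "card S * c \<le> card {y \<in> A. f m \<le> f y} * c"
      using assms by (intro mult_le_mono1 card_mono) auto
    also have "\<dots> \<le> N"
      using m(1) by (simp add: S_def)
    finally show ?thesis .
  qed simp
  then show ?thesis
    by (simp add: S_def)
qed

lemma pairs_eq: "pairs n = n * (n - 1) div 2"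
  using Sum_Ico_nat[of 0 n] by (simp add: pairs_def lessThan_atLeast0)

lemma pairs_eq_choose: "pairs n = n choose 2"
  by (simp add: pairs_eq choose_two)

text \<open>Splits the weight of a graph: \<open>pairs k\<close> pays for the
  \<open>2 ^ pairs k\<close> graphs on \<open>k\<close> nodes, and \<open>k div 2\<close> is left
  for the sum over \<open>k\<close>.\<close>

lemma pairs_add_half: "pairs k + k div 2 = k * k div 2"
proof (induction k)
  case (Suc k)
  show ?case
  proof (cases "even k")
    case True
    then obtain m where "k = 2 * m"
      by blast
    then show ?thesis
      by (simp add: pairs_eq algebra_simps)
  next
    case False
    then obtain m where "k = 2 * m + 1"
      by (auto elim: oddE)
    then show ?thesis
      by (simp add: pairs_eq algebra_simps)
  qed
qed (simp add: pairs_def)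

text \<open>Each power occurs for two consecutive \<open>k\<close>, so the limit is twice the
  geometric series 2.\<close>

lemma sum_half_powers: "(\<Sum>k<n. (1 / 2) ^ (k div 2) :: real) \<le> 4"
proof -
  have "(\<Sum>k<2 * m. (1 / 2) ^ (k div 2) :: real) = 4 - 4 * (1 / 2) ^ m" for m
    by (induction m) (auto simp: power_divide)
  moreover have "(\<Sum>k<n. (1 / 2) ^ (k div 2) :: real) \<le> (\<Sum>k<2 * n. (1 / 2) ^ (k div 2))"
    by (intro sum_mono2) auto
  ultimately show ?thesis
    by (simp add: order_trans[of _ "4 - 4 * (1 / 2) ^ n"])
qed

lemma deviation_rank_eq_card:
  "deviation_rank n k e g = card {h \<in> {..<2 ^ pairs n}. deviation n k e g \<le> deviation n k e h}"
  unfolding deviation_rank_def by (simp add: Collect_conj_eq lessThan_def)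

text \<open>A union bound over \<open>k\<close> and \<open>e\<close>; the 2 in the exponent is the
  bound 4 on the sum of the weights.\<close>

lemma card_atypical: "card {g. g < 2 ^ pairs n \<and> atypical n r g} * 2 ^ r \<le> 2 ^ (pairs n + 2)"
proof -
  define S where "S k e = {g \<in> {..<2 ^ pairs n}. deviation_rank n k e g * 2 ^ (r + k * k div 2) \<le> 2 ^ pairs n}" for k e
  have fin: "finite (S k e)" for k e
    by (simp add: S_def)
  have S: "real (card (S k e)) * 2 ^ r * 2 ^ pairs k \<le> 2 ^ pairs n * (1 / 2) ^ (k div 2)" for k e
  proof -
    have "card (S k e) * 2 ^ (r + k * k div 2) \<le> 2 ^ pairs n"
      unfolding S_def deviation_rank_eq_card by (rule card_low_rank) simp
    then have "real (card (S k e) * 2 ^ (r + k * k div 2)) \<le> real (2 ^ pairs n)"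
      by (simp only: of_nat_le_iff)
    then show ?thesis
      by (simp add: pairs_add_half[symmetric] power_add power_divide field_simps)
  qed
  have "{g. g < 2 ^ pairs n \<and> atypical n r g} = (\<Union>k<Suc n. \<Union>e<2 ^ pairs k. S k e)"
    by (auto simp: atypical_def S_def)
  then have "card {g. g < 2 ^ pairs n \<and> atypical n r g} = card (\<Union>k<Suc n. \<Union>e<2 ^ pairs k. S k e)"
    by (rule arg_cong)
  also have "\<dots> \<le> (\<Sum>k<Suc n. card (\<Union>e<2 ^ pairs k. S k e))"
    by (rule card_UN_le) simp
  also have "\<dots> \<le> (\<Sum>k<Suc n. \<Sum>e<2 ^ pairs k. card (S k e))"
    by (intro sum_mono card_UN_le) simp
  finally have "real (card {g. g < 2 ^ pairs n \<and> atypical n r g}) \<le> real (\<Sum>k<Suc n. \<Sum>e<2 ^ pairs k. card (S k e))"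
    by (simp only: of_nat_le_iff)
  then have "real (card {g. g < 2 ^ pairs n \<and> atypical n r g}) * 2 ^ r \<le>
      (\<Sum>k<Suc n. \<Sum>e<2 ^ pairs k. real (card (S k e))) * 2 ^ r"
    unfolding of_nat_sum by (rule mult_right_mono) simp
  also have "\<dots> = (\<Sum>k<Suc n. \<Sum>e<2 ^ pairs k. real (card (S k e)) * 2 ^ r)"
    by (simp only: sum_distrib_right)
  also have "\<dots> \<le> (\<Sum>k<Suc n. \<Sum>e<(2 :: nat) ^ pairs k. 2 ^ pairs n * (1 / 2) ^ (k div 2) / 2 ^ pairs k)"
    using S by (intro sum_mono) (simp add: pos_le_divide_eq)
  also have "\<dots> = 2 ^ pairs n * (\<Sum>k<Suc n. (1 / 2) ^ (k div 2))"
    by (simp add: sum_distrib_left del: sum.lessThan_Suc)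
  also have "\<dots> \<le> 2 ^ pairs n * 4"
    by (intro mult_left_mono sum_half_powers) simp
  finally have "real (card {g. g < 2 ^ pairs n \<and> atypical n r g} * 2 ^ r) \<le> real (2 ^ (pairs n + 2))"
    by (simp add: power_add)
  then show ?thesis
    by (simp only: of_nat_le_iff)
qed

lemma complexity_atypical:
  assumes "universal_for turing_machine U"
  shows "\<exists>c. \<forall>n r g. g < 2 ^ pairs n \<and> atypical n r g \<longrightarrow>
    complexity U (map (bit g) [0..<pairs n]) (str n) + r \<le> pairs n + c"
proof -
  obtain M where "turing_machine M" and M: "\<And>p n. tm_fun M (pair p (str n)) =
     Some (map (bit (nth_atypical n (pairs n + 2 - length p) (\<Sum>i<length p. of_bool (p ! i) * 2 ^ i))) [0..<pairs n])"
    using atypical_machine by blast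
  then obtain c where c: "\<And>p x y. tm_fun M (pair p y) = Some x \<Longrightarrow> complexity U x y \<le> length p + c"
    using universal_simulates[OF assms] by blast
  have "complexity U (map (bit g) [0..<pairs n]) (str n) + r \<le> pairs n + (c + 2)"
    if g: "g < 2 ^ pairs n" "atypical n r g" for n r g
  proof -
    let ?A = "{h. h < 2 ^ pairs n \<and> atypical n r h}"
    define i where "i = card {h. h < g \<and> atypical n r h}"
    have "{h. h < g \<and> atypical n r h} \<subset> ?A"
      using g by auto
    then have "i < card ?A"
      unfolding i_def by (intro psubset_card_mono) auto
    then have "i * 2 ^ r < card ?A * 2 ^ r"
      by simp
    also have "\<dots> \<le> 2 ^ (pairs n + 2)"
      by (rule card_atypical)
    finally have bound: "i * 2 ^ r < 2 ^ (pairs n + 2)" .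
    \<comment> \<open>As some graph is atypical at level \<open>r\<close>, the level is at most
      \<open>pairs n + 2\<close>. Beyond that the truncated difference in the machine could not
      recover it.\<close>
    have "1 * 2 ^ r \<le> card ?A * 2 ^ r"
      using \<open>i < card ?A\<close> by (intro mult_le_mono1) simp
    also have "\<dots> \<le> 2 ^ (pairs n + 2)"
      by (rule card_atypical)
    finally have "(2 :: nat) ^ r \<le> 2 ^ (pairs n + 2)"
      by simp
    then have r: "r \<le> pairs n + 2"
      by (rule power_le_imp_le_exp[rotated]) simp
    \<comment> \<open>The index is padded to exactly \<open>L\<close> bits, so the machine finds the
      level again as \<open>pairs n + 2 - L\<close>.\<close>
    define L where "L = pairs n + 2 - r"
    have "i * 2 ^ r < 2 ^ L * 2 ^ r"
      using bound r by (simp add: L_def flip: power_add)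
    then have "i < 2 ^ L"
      by simp
    then have "(\<Sum>j<L. of_bool (bit i j) * 2 ^ j) = i"
      using horner_sum_bit_eq_take_bit[of i L] by (simp add: horner_sum_eq_sum take_bit_nat_eq_self lessThan_atLeast0)
    moreover have "nth_atypical n r i = g"
      unfolding nth_atypical_def i_def using g by (intro count_enumeration) auto
    ultimately have "tm_fun M (pair (map (bit i) [0..<L]) (str n)) = Some (map (bit g) [0..<pairs n])"
      using r by (simp add: M L_def)
    from c[OF this] show ?thesis
      using r by (simp add: L_def)
  qed
  then show ?thesis
    by blast
qed

section \<open>Graphs and their codes\<close>

definition graph_of :: "nat \<Rightarrow> nat \<Rightarrow> nat set set" where
  "graph_of n g = {{i, j} | i j. 1 \<le> i \<and> i < j \<and> j \<le> n \<and> bit g (edge_index n i j)}"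

lemma doubleton_in_graph_of:
  assumes "1 \<le> i" "i < j" "j \<le> n"
  shows "{i, j} \<in> graph_of n g \<longleftrightarrow> bit g (edge_index n i j)"
  using assms by (force simp: graph_of_def doubleton_eq_iff)

lemma graph_of_subset: "graph_of n g \<subseteq> nsets {1..n} 2"
  by (auto simp: graph_of_def)

lemma card_nsets: "finite A \<Longrightarrow> card (nsets A k) = card A choose k"
  by (simp add: nsets_def n_subsets finite_subset[of _ A] cong: conj_cong)

lemma pairs_reverse: "pairs n = (\<Sum>u<n. n - Suc u)"
  unfolding pairs_def by (rule sum.nat_diff_reindex[symmetric])

lemma encode_graph_of: "encode n (graph_of n g) = map (bit g) [0..<pairs n]"
proof -
  \<comment> \<open>Generalised to the first \<open>m\<close> rows, whose total length is the offset
    of the next row in \<open>edge_index\<close>.\<close>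
  have "concat (map (\<lambda>i. map (\<lambda>j. {i, j} \<in> graph_of n g) [i+1..<n+1]) [1..<m+1])
      = map (bit g) [0..<(\<Sum>u<m. n - Suc u)]" if "m \<le> n" for m
    using that
  proof (induction m)
    case (Suc m)
    let ?s = "\<Sum>u<m. n - Suc u"
    have "map (\<lambda>j. {Suc m, j} \<in> graph_of n g) [Suc (Suc m)..<Suc n] = map (bit g) [?s..<?s + (n - Suc m)]"
      by (rule nth_equalityI) (auto simp: doubleton_in_graph_of edge_index_def simp del: upt_Suc)
    moreover have "[0..<?s + (n - Suc m)] = [0..<?s] @ [?s..<?s + (n - Suc m)]"
      by (rule upt_add_eq_append) simp
    ultimately show ?case
      using Suc by simp
  qed simp
  from this[of n] show ?thesis
    by (simp add: encode_def pairs_reverse del: upt_Suc)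
qed

text \<open>The encoding of the graph returns the digits of its code, which gives injectivity;
  surjectivity follows by counting.\<close>

lemma bij_graph_of: "bij_betw (graph_of n) {..<2 ^ pairs n} (Pow (nsets {1..n} 2))"
proof -
  have "inj_on (graph_of n) {..<2 ^ pairs n}"
  proof (rule inj_onI)
    fix g h
    assume gh: "g \<in> {..<2 ^ pairs n}" "h \<in> {..<2 ^ pairs n}" and "graph_of n g = graph_of n h"
    then have "map (bit g) [0..<pairs n] = map (bit h) [0..<pairs n]"
      by (metis encode_graph_of)
    then have "take_bit (pairs n) g = take_bit (pairs n) h"
      by (metis horner_sum_bit_eq_take_bit)
    then show "g = h"
      using gh by (simp add: take_bit_nat_eq_self)
  qed
  moreover have "card (nsets {1..n} 2) = pairs n"
    by (simp add: card_nsets pairs_eq_choose)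
  ultimately show ?thesis
    using graph_of_subset
    by (intro bij_betw_imageI card_subset_eq) (auto simp: finite_imp_finite_nsets card_Pow card_image)
qed

section \<open>Node sets as bit masks\<close>

lemma set_decode_eq_bits: "set_decode s = {v. bit s v}"
  by (simp add: set_decode_def bit_iff_odd)

lemma bij_set_decode: "bij_betw set_decode {..<2 ^ m} (Pow {..<m})"
proof -
  have "set_decode s \<subseteq> {..<m}" if "s < 2 ^ m" for s
    using bit_take_bit_iff[of m s] that by (auto simp: set_decode_eq_bits take_bit_nat_eq_self)
  moreover have "inj_on set_decode {..<2 ^ m}"
    by (rule inj_on_inverseI) (rule set_decode_inverse)
  ultimately show ?thesis
    by (intro bij_betw_imageI card_subset_eq) (auto simp: card_Pow card_image)
qed

lemma mask_rank_eq_rank: "mask_rank s v = rank (set_decode s) v"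
proof -
  have "{..<Suc v} \<inter> {u. bit s u} = {u \<in> set_decode s. u \<le> v}"
    by (auto simp: set_decode_eq_bits)
  then show ?thesis
    by (simp add: mask_rank_def rank_def del: sum.lessThan_Suc)
qed

lemma mask_iff:
  assumes "s < 2 ^ Suc n"
  shows "mask n k s \<longleftrightarrow> set_decode s \<in> nsets {1..n} k"
proof -
  have sub: "set_decode s \<subseteq> {..<Suc n}"
    using bij_set_decode[of "Suc n"] assms by (auto simp: bij_betw_def)
  then have "{u \<in> set_decode s. u \<le> n} = set_decode s"
    by auto
  moreover have "set_decode s \<subseteq> {1..n} \<longleftrightarrow> 0 \<notin> set_decode s"
  proof
    assume nz: "0 \<notin> set_decode s"
    show "set_decode s \<subseteq> {1..n}"
    proof
      fix x
      assume x: "x \<in> set_decode s"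
      then have "x \<noteq> 0" "x < Suc n"
        using sub nz by (metis, blast)
      then show "x \<in> {1..n}"
        by simp
    qed
  qed (auto simp del: set_decode_0)
  moreover have "bit s 0 \<longleftrightarrow> 0 \<in> set_decode s"
    by (simp only: set_decode_eq_bits mem_Collect_eq)
  ultimately show ?thesis
    unfolding mask_def mask_rank_eq_rank rank_def nsets_def by (simp del: set_decode_0)
qed

lemma sum_masks:
  assumes "\<And>s. s < 2 ^ Suc n \<Longrightarrow> mask n k s \<Longrightarrow> P s \<longleftrightarrow> Q (set_decode s)"
  shows "(\<Sum>s<2 ^ Suc n. of_bool (mask n k s \<and> P s)) = card {S \<in> nsets {1..n} k. Q S}"
proof -
  have "bij_betw set_decode {s \<in> {..<2 ^ Suc n}. mask n k s \<and> P s} {S \<in> nsets {1..n} k. Q S}"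
  proof (rule bij_betw_subset[OF bij_set_decode[of "Suc n"]])
    show "set_decode ` {s \<in> {..<2 ^ Suc n}. mask n k s \<and> P s} = {S \<in> nsets {1..n} k. Q S}"
    proof (intro equalityI subsetI)
      fix S
      assume S: "S \<in> {S \<in> nsets {1..n} k. Q S}"
      then have "S \<subseteq> {..<Suc n}"
        by (auto simp: nsets_def less_Suc_eq_le)
      then obtain s where "s < 2 ^ Suc n" "S = set_decode s"
        using bij_set_decode[of "Suc n"] by (auto simp: bij_betw_def image_iff dest!: equalityD2)
      then show "S \<in> set_decode ` {s \<in> {..<2 ^ Suc n}. mask n k s \<and> P s}"
        using S assms by (auto simp: mask_iff)
    qed (use assms in \<open>auto simp: mask_iff\<close>)
  qed auto
  moreover have "{..<2 ^ Suc n} \<inter> {s. mask n k s \<and> P s} = {s \<in> {..<2 ^ Suc n}. mask n k s \<and> P s}"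
    by auto
  ultimately show ?thesis
    by (simp add: bij_betw_same_card del: sum.lessThan_Suc power_Suc)
qed

lemma masks_eq_choose: "masks n k = n choose k"
proof -
  have "masks n k = card (nsets {1..n} k)"
    using sum_masks[of n k "\<lambda>_. True" "\<lambda>_. True"] by (simp add: masks_def del: sum.lessThan_Suc power_Suc)
  also have "\<dots> = n choose k"
    by (simp add: card_nsets)
  finally show ?thesis .
qed

section \<open>Ranks and occurrences\<close>

lemma rank_less:
  assumes "finite S" "u < v" "v \<in> S"
  shows "rank S u < rank S v"
proof -
  have "{w \<in> S. w \<le> u} \<subseteq> {w \<in> S. w \<le> v}" "v \<in> {w \<in> S. w \<le> v}" "v \<notin> {w \<in> S. w \<le> u}"
    using assms by auto
  then have "{w \<in> S. w \<le> u} \<subset> {w \<in> S. w \<le> v}"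
    by blast
  then show ?thesis
    unfolding rank_def using assms(1) by (intro psubset_card_mono) auto
qed

lemma bij_betw_rank:
  assumes "finite S"
  shows "bij_betw (rank S) S {1..card S}"
proof (rule bij_betw_imageI)
  show inj: "inj_on (rank S) S"
    using rank_less[OF assms] by (intro linorder_inj_onI') (metis less_irrefl)
  have "rank S v \<in> {1..card S}" if "v \<in> S" for v
    unfolding rank_def using assms that by (auto simp: Suc_le_eq card_gt_0_iff intro: card_mono)
  then show "rank S ` S = {1..card S}"
    using inj by (intro card_subset_eq) (auto simp: card_image)
qed

text \<open>Ranking is a bijection between the pairs in \<open>S\<close> and those in
  \<open>{1..k}\<close>, so equality of edge sets becomes one condition for each pair in
  \<open>S\<close>. For a random graph these are \<open>k choose 2\<close> independent bits.\<close>

lemma occurrence_iff: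
  assumes "S \<in> nsets A k" "H \<subseteq> nsets {1..k} 2" "G \<subseteq> nsets A 2"
  shows "occurrence H G S \<longleftrightarrow> (\<forall>e\<in>nsets S 2. e \<in> G \<longleftrightarrow> rank S ` e \<in> H)"
proof -
  have bij: "bij_betw (image (rank S)) (nsets S 2) (nsets {1..k} 2)"
    using assms(1) bij_betw_rank[of S] by (intro bij_betw_nsets) (auto simp: nsets_def)
  have ind: "induced G S = G \<inter> nsets S 2"
    using assms(3) by (auto simp: induced_def nsets_def)
  have "occurrence H G S \<longleftrightarrow> image (rank S) ` (G \<inter> nsets S 2) = H"
    by (simp add: occurrence_def ind)
  also have "\<dots> \<longleftrightarrow> (\<forall>e\<in>nsets S 2. e \<in> G \<longleftrightarrow> rank S ` e \<in> H)"
  proof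
    assume eq: "image (rank S) ` (G \<inter> nsets S 2) = H"
    show "\<forall>e\<in>nsets S 2. e \<in> G \<longleftrightarrow> rank S ` e \<in> H"
    proof
      fix e
      assume e: "e \<in> nsets S 2"
      show "e \<in> G \<longleftrightarrow> rank S ` e \<in> H"
        unfolding eq[symmetric]
        using inj_on_image_mem_iff[OF bij_betw_imp_inj_on[OF bij] e, of "G \<inter> nsets S 2"] e by auto
    qed
  next
    assume *: "\<forall>e\<in>nsets S 2. e \<in> G \<longleftrightarrow> rank S ` e \<in> H"
    show "image (rank S) ` (G \<inter> nsets S 2) = H"
    proof (intro equalityI subsetI)
      fix d
      assume "d \<in> H"
      then have "d \<in> image (rank S) ` nsets S 2"
        using assms(2) bij by (auto simp: bij_betw_def)
      then show "d \<in> image (rank S) ` (G \<inter> nsets S 2)"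
        using * \<open>d \<in> H\<close> by auto
    qed (use * in auto)
  qed
  finally show ?thesis .
qed

lemma ball_nsets_2_iff: "(\<forall>e\<in>nsets S 2. P e) \<longleftrightarrow> (\<forall>i\<in>S. \<forall>j\<in>S. i < j \<longrightarrow> P {i, j})" for S :: "nat set"
  unfolding ordered_nsets_2_eq by blast

lemma occurrence_graph_of_iff:
  assumes "S \<in> nsets {1..n} k"
  shows "occurrence (graph_of k e) (graph_of n g) S \<longleftrightarrow>
    (\<forall>i\<in>S. \<forall>j\<in>S. i < j \<longrightarrow> (bit g (edge_index n i j) \<longleftrightarrow> bit e (edge_index k (rank S i) (rank S j))))"
proof -
  have S: "finite S" "card S = k" "S \<subseteq> {1..n}"
    using assms by (auto simp: nsets_def)
  have rank: "1 \<le> rank S i" "rank S i \<le> k" if "i \<in> S" for i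
    using bij_betw_rank[OF S(1)] that S(2) by (auto simp: bij_betw_def)
  have "{i, j} \<in> graph_of n g \<longleftrightarrow> bit g (edge_index n i j)"
    "rank S ` {i, j} \<in> graph_of k e \<longleftrightarrow> bit e (edge_index k (rank S i) (rank S j))"
    if ij: "i \<in> S" "j \<in> S" "i < j" for i j
  proof -
    show "{i, j} \<in> graph_of n g \<longleftrightarrow> bit g (edge_index n i j)"
      using ij S(3) by (intro doubleton_in_graph_of) auto
    have "{rank S i, rank S j} \<in> graph_of k e \<longleftrightarrow> bit e (edge_index k (rank S i) (rank S j))"
      using ij rank rank_less[OF S(1)] by (intro doubleton_in_graph_of) auto
    then show "rank S ` {i, j} \<in> graph_of k e \<longleftrightarrow> bit e (edge_index k (rank S i) (rank S j))"
      by simp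
  qed
  then show ?thesis
    unfolding occurrence_iff[OF assms graph_of_subset graph_of_subset] ball_nsets_2_iff by blast
qed

lemma occurrences_code_eq: "occurrences_code n k e g = occurrences k (graph_of k e) n (graph_of n g)"
  unfolding occurrences_code_def occurrences_def
proof (rule sum_masks)
  fix s
  assume s: "s < 2 ^ Suc n" "mask n k s"
  then have S: "set_decode s \<in> nsets {1..n} k"
    by (simp only: mask_iff)
  then have "i < Suc n" if "i \<in> set_decode s" for i
    using that by (auto simp: nsets_def)
  then show "occurrence_code n k e g s \<longleftrightarrow> occurrence (graph_of k e) (graph_of n g) (set_decode s)"
    unfolding occurrence_graph_of_iff[OF S] occurrence_code_def mask_rank_eq_rank
    unfolding set_decode_eq_bits by blast
qed

lemma real_deviation:
  "real (deviation n k e g) =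
    2 ^ pairs k * \<bar>real (occurrences k (graph_of k e) n (graph_of n g)) - real (n choose k) / 2 ^ pairs k\<bar>"
proof -
  have dist: "real (a - b + (b - a)) = \<bar>real a - real b\<bar>" for a b
    by (cases "a \<le> b") (auto simp: of_nat_diff)
  have "\<bar>2 ^ pairs k * x - c\<bar> = 2 ^ pairs k * \<bar>x - c / 2 ^ pairs k\<bar>" for x c :: real
  proof -
    have "2 ^ pairs k * x - c = 2 ^ pairs k * (x - c / 2 ^ pairs k)"
      by (simp add: right_diff_distrib)
    then show ?thesis
      by (simp only: abs_mult) simp
  qed
  then show ?thesis
    unfolding deviation_def dist occurrences_code_eq masks_eq_choose by simp
qed

text \<open>Ranks count codes, whereas the concentration bound counts graphs; the bijection between
  the two links them.\<close>

lemma deviation_rank_le_card: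
  assumes "D \<le> \<bar>real (occurrences k (graph_of k e) n (graph_of n g)) - real (n choose k) / 2 ^ pairs k\<bar>"
  shows "deviation_rank n k e g \<le>
    card {A \<in> Pow (nsets {1..n} 2). D \<le> \<bar>real (occurrences k (graph_of k e) n A) - real (n choose k) / 2 ^ pairs k\<bar>}"
proof -
  let ?x = "\<lambda>A. \<bar>real (occurrences k (graph_of k e) n A) - real (n choose k) / 2 ^ pairs k\<bar>"
  have "deviation n k e g \<le> deviation n k e h \<longleftrightarrow> ?x (graph_of n g) \<le> ?x (graph_of n h)" for h
    unfolding of_nat_le_iff[where 'a = real, symmetric] real_deviation by simp
  then have "deviation_rank n k e g = card {h \<in> {..<2 ^ pairs n}. ?x (graph_of n g) \<le> ?x (graph_of n h)}"
    by (simp add: deviation_rank_eq_card)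
  also have "\<dots> \<le> card {A \<in> Pow (nsets {1..n} 2). D \<le> ?x A}"
  proof (rule card_inj_on_le)
    show "inj_on (graph_of n) {h \<in> {..<2 ^ pairs n}. ?x (graph_of n g) \<le> ?x (graph_of n h)}"
      using bij_graph_of[of n] by (auto simp: bij_betw_def intro: inj_on_subset)
    show "graph_of n ` {h \<in> {..<2 ^ pairs n}. ?x (graph_of n g) \<le> ?x (graph_of n h)} \<subseteq> {A \<in> Pow (nsets {1..n} 2). D \<le> ?x A}"
      using assms graph_of_subset by fastforce
  qed (simp add: finite_imp_finite_nsets)
  finally show ?thesis .
qed

section \<open>Concentration of the number of occurrences\<close>

lemma sum_Pow_insert:
  assumes "finite E" "e \<notin> E"
  shows "(\<Sum>A\<in>Pow (insert e E). h A) = (\<Sum>A\<in>Pow E. h A) + (\<Sum>A\<in>Pow E. h (insert e A))"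
proof -
  have "inj_on (insert e) (Pow E)"
    using assms(2) by (intro inj_onI) (metis PowD insert_ident subsetD)
  moreover have "Pow E \<inter> insert e ` Pow E = {}"
    using assms(2) by auto
  ultimately show ?thesis
    using assms(1) by (simp add: Pow_insert sum.union_disjoint sum.reindex)
qed

text \<open>\<open>cosh x\<close> is even at most \<open>exp (x^2 / 2)\<close>. The weaker exponent
  has an elementary proof: quadratic bounds for \<open>x\<close> between 0 and 1, and
  \<open>x \<le> x^2\<close> above 1.\<close>

lemma average_exp_le: "(exp x + exp (- x)) / 2 \<le> exp (x\<^sup>2)" for x :: real
proof -
  have nonneg: "(exp y + exp (- y)) / 2 \<le> exp (y\<^sup>2)" if "0 \<le> y" for y :: real
  proof (cases "y \<le> 1")
    case True
    have "exp (- y) \<le> 1 / (1 + y)"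
      using exp_ge_add_one_self[of y] that by (simp add: exp_minus field_simps)
    \<comment> \<open>Because \<open>(1 + y) (1 - y + y^2) = 1 + y^3\<close>.\<close>
    also have "\<dots> \<le> 1 - y + y\<^sup>2"
      using that by (simp add: field_simps power2_eq_square)
    finally have "exp y + exp (- y) \<le> 2 * (1 + y\<^sup>2)"
      using exp_bound[OF that True] by simp
    also have "\<dots> \<le> 2 * exp (y\<^sup>2)"
      by (intro mult_left_mono exp_ge_add_one_self) simp
    finally show ?thesis
      by simp
  next
    case False
    then have "- y \<le> y" "y \<le> y\<^sup>2"
      by (auto simp: power2_eq_square)
    then have "exp y \<le> exp (y\<^sup>2)" "exp (- y) \<le> exp (y\<^sup>2)"
      unfolding exp_le_cancel_iff by linarith+
    then have "exp y + exp (- y) \<le> exp (y\<^sup>2) + exp (y\<^sup>2)"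
      by (rule add_mono)
    then show ?thesis
      by simp
  qed
  show ?thesis
    using nonneg[of x] nonneg[of "- x"] by (cases "0 \<le> x") (auto simp: add.commute)
qed

text \<open>McDiarmid's inequality on the cube, with a weaker constant in the exponent: the elements of
  the ground set are exposed one at a time.\<close>

lemma exponential_moment_Pow:
  fixes f :: "'a set \<Rightarrow> real" and c :: real
  assumes "finite E" "0 \<le> c"
    and "\<And>A e. A \<subseteq> E \<Longrightarrow> e \<in> E \<Longrightarrow> e \<notin> A \<Longrightarrow> \<bar>f (insert e A) - f A\<bar> \<le> c"
  shows "(\<Sum>A\<in>Pow E. exp (l * (f A - (\<Sum>B\<in>Pow E. f B) / 2 ^ card E))) \<le>
    2 ^ card E * exp (card E * (l * c)\<^sup>2 / 4)"
  using assms(1,3)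
proof (induction E arbitrary: f rule: finite_induct)
  case (insert e E)
  let ?m = "\<lambda>f. (\<Sum>B\<in>Pow E. f B) / 2 ^ card E"
  let ?f = "\<lambda>A. f (insert e A)"
  \<comment> \<open>The means over the sets without and with \<open>e\<close> lie symmetrically
    about the overall mean \<open>m\<close>; multiplied by \<open>l\<close>, their offsets are
    \<open>- d\<close> and \<open>d\<close>. Averaging the two factors \<open>exp (- d)\<close> and
    \<open>exp d\<close> produces \<open>cosh d\<close>.\<close>
  define m where "m = (?m f + ?m ?f) / 2"
  define d where "d = l * (?m ?f - ?m f) / 2"
  define M where "M = exp (card E * (l * c)\<^sup>2 / 4)"
  have mean: "(\<Sum>B\<in>Pow (insert e E). f B) / 2 ^ card (insert e E) = m"
    using insert.hyps by (simp add: sum_Pow_insert m_def add_divide_distrib)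
  have 1: "(\<Sum>A\<in>Pow E. exp (l * (f A - ?m f))) \<le> 2 ^ card E * M"
    unfolding M_def by (rule insert.IH) (use insert.prems in auto)
  have 2: "(\<Sum>A\<in>Pow E. exp (l * (?f A - ?m ?f))) \<le> 2 ^ card E * M"
    unfolding M_def
  proof (rule insert.IH)
    fix A a
    assume "A \<subseteq> E" "a \<in> E" "a \<notin> A"
    then show "\<bar>?f (insert a A) - ?f A\<bar> \<le> c"
      using insert.prems[of "insert e A" a] insert.hyps by (auto simp: insert_commute)
  qed
  have "?m ?f - ?m f = (\<Sum>A\<in>Pow E. ?f A - f A) / 2 ^ card E"
    by (simp add: sum_subtractf diff_divide_distrib)
  also have "\<bar>\<dots>\<bar> \<le> (\<Sum>A\<in>Pow E. \<bar>?f A - f A\<bar>) / 2 ^ card E"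
    by (simp add: divide_right_mono)
  also have "\<dots> \<le> (\<Sum>A\<in>Pow E. c) / 2 ^ card E"
    using insert.prems insert.hyps by (intro divide_right_mono sum_mono) (auto dest: subsetD)
  also have "\<dots> = c"
    using insert.hyps by (simp add: card_Pow)
  finally have "\<bar>d\<bar> \<le> \<bar>l\<bar> * c / 2"
    by (simp add: d_def abs_mult mult_left_mono)
  then have "\<bar>d\<bar>\<^sup>2 \<le> (\<bar>l\<bar> * c / 2)\<^sup>2"
    by (intro power_mono) auto
  then have d: "d\<^sup>2 \<le> (l * c)\<^sup>2 / 4"
    by (simp add: power_mult_distrib power_divide)
  have shift: "l * (f A - m) = - d + l * (f A - ?m f)" "l * (?f A - m) = d + l * (?f A - ?m ?f)" for A
    by (simp_all add: m_def d_def field_simps)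
  have "(\<Sum>A\<in>Pow (insert e E). exp (l * (f A - m)))
      = exp (- d) * (\<Sum>A\<in>Pow E. exp (l * (f A - ?m f))) + exp d * (\<Sum>A\<in>Pow E. exp (l * (?f A - ?m ?f)))"
    unfolding sum_Pow_insert[OF insert.hyps(1,2)] sum_distrib_left
    by (rule arg_cong2[where f = "(+)"]; rule sum.cong[OF refl])
      (simp_all only: exp_add[symmetric] exp_inj_iff, rule shift(1), rule shift(2))
  also have "\<dots> \<le> exp (- d) * (2 ^ card E * M) + exp d * (2 ^ card E * M)"
    using 1 2 by (intro add_mono mult_left_mono) auto
  also have "\<dots> = ((exp d + exp (- d)) / 2) * (2 ^ card (insert e E) * M)"
    using insert.hyps by (simp add: field_simps)
  also have "\<dots> \<le> exp ((l * c)\<^sup>2 / 4) * (2 ^ card (insert e E) * M)"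
    using average_exp_le[of d] d by (intro mult_right_mono) (auto simp: M_def elim: order_trans)
  also have "\<dots> = 2 ^ card (insert e E) * exp (card (insert e E) * (l * c)\<^sup>2 / 4)"
    using insert.hyps by (simp add: M_def exp_add[symmetric] add_divide_distrib distrib_right)
  finally show ?case
    unfolding mean .
qed simp

lemma card_deviation_Pow:
  fixes f :: "'a set \<Rightarrow> real" and c :: real
  assumes "finite E" "E \<noteq> {}" "0 < c" "0 \<le> d"
    and "\<And>A e. A \<subseteq> E \<Longrightarrow> e \<in> E \<Longrightarrow> e \<notin> A \<Longrightarrow> \<bar>f (insert e A) - f A\<bar> \<le> c"
  defines "m \<equiv> (\<Sum>A\<in>Pow E. f A) / 2 ^ card E"
  shows "card {A \<in> Pow E. d \<le> \<bar>f A - m\<bar>} \<le> 2 * 2 ^ card E * exp (- d\<^sup>2 / (card E * c\<^sup>2))"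
proof -
  let ?N = "real (card E)"
  have N: "0 < ?N"
    using assms(1,2) by (simp add: card_gt_0_iff)
  have tail: "card {A \<in> Pow E. d \<le> t * (f A - m)} \<le> 2 ^ card E * exp (- d\<^sup>2 / (?N * c\<^sup>2))"
    if "t = 1 \<or> t = -1" for t :: real
  proof -
    \<comment> \<open>Chernoff's choice, the minimum of \<open>N (l c)^2 / 4 - l d\<close> with
      \<open>N = card E\<close>. The sign \<open>t\<close> treats both tails at once.\<close>
    define l where "l = 2 * d / (?N * c\<^sup>2)"
    have "0 \<le> l"
      using assms(3,4) by (simp add: l_def)
    have "real (card {A \<in> Pow E. d \<le> t * (f A - m)}) * exp (l * d) = (\<Sum>A\<in>{A \<in> Pow E. d \<le> t * (f A - m)}. exp (l * d))"
      by simp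
    also have "\<dots> \<le> (\<Sum>A\<in>{A \<in> Pow E. d \<le> t * (f A - m)}. exp (l * (t * (f A - m))))"
      using \<open>0 \<le> l\<close> by (intro sum_mono) (auto intro: mult_left_mono)
    also have "\<dots> \<le> (\<Sum>A\<in>Pow E. exp (l * (t * (f A - m))))"
      using assms(1) by (intro sum_mono2) auto
    also have "\<dots> = (\<Sum>A\<in>Pow E. exp ((l * t) * (f A - m)))"
      by (simp add: mult.assoc)
    also have "\<dots> \<le> 2 ^ card E * exp (?N * (l * t * c)\<^sup>2 / 4)"
      unfolding m_def using assms by (intro exponential_moment_Pow) auto
    also have "?N * (l * t * c)\<^sup>2 / 4 = d\<^sup>2 / (?N * c\<^sup>2)"
      using that N assms(3) by (auto simp: l_def power_mult_distrib power_divide power2_eq_square)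
    also have "l * d = d\<^sup>2 / (?N * c\<^sup>2) + d\<^sup>2 / (?N * c\<^sup>2)"
      by (simp add: l_def power2_eq_square mult_ac)
    finally have "real (card {A \<in> Pow E. d \<le> t * (f A - m)}) * exp (d\<^sup>2 / (?N * c\<^sup>2)) * exp (d\<^sup>2 / (?N * c\<^sup>2))
        \<le> 2 ^ card E * exp (d\<^sup>2 / (?N * c\<^sup>2))"
      by (simp only: exp_add mult.assoc)
    then have "real (card {A \<in> Pow E. d \<le> t * (f A - m)}) * exp (d\<^sup>2 / (?N * c\<^sup>2)) \<le> 2 ^ card E"
      by (rule mult_right_le_imp_le) simp
    then show ?thesis
      by (simp add: exp_minus field_simps)
  qed
  let ?S = "\<lambda>t. {A \<in> Pow E. d \<le> t * (f A - m)}"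
  have "{A \<in> Pow E. d \<le> \<bar>f A - m\<bar>} = ?S 1 \<union> ?S (-1)"
    by (auto simp: abs_if)
  then have "card {A \<in> Pow E. d \<le> \<bar>f A - m\<bar>} \<le> card (?S 1) + card (?S (-1))"
    by (simp only: card_Un_le)
  then have "real (card {A \<in> Pow E. d \<le> \<bar>f A - m\<bar>}) \<le> real (card (?S 1)) + real (card (?S (-1)))"
    by (simp only: of_nat_le_iff flip: of_nat_add)
  also have "\<dots> \<le> 2 ^ card E * exp (- d\<^sup>2 / (?N * c\<^sup>2)) + 2 ^ card E * exp (- d\<^sup>2 / (?N * c\<^sup>2))"
    by (intro add_mono tail) auto
  finally show ?thesis
    by simp
qed

text \<open>An occurrence on \<open>S\<close> prescribes the trace \<open>J\<close> of the graph on
  the pairs in \<open>S\<close> and leaves all other pairs free.\<close>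

lemma card_occurrence:
  assumes S: "S \<in> nsets {1..n} k" and H: "H \<subseteq> nsets {1..k} 2"
  shows "real (card {A \<in> Pow (nsets {1..n} 2). occurrence H A S}) = 2 ^ pairs n / 2 ^ pairs k"
proof -
  let ?E = "nsets {1..n} 2" and ?D = "nsets S 2"
  define J where "J = {e \<in> ?D. rank S ` e \<in> H}"
  have "finite S" "card S = k" "S \<subseteq> {1..n}"
    using S by (auto simp: nsets_def)
  then have D: "?D \<subseteq> ?E" "finite ?D" "card ?D = pairs k"
    by (auto simp: nsets_mono finite_imp_finite_nsets card_nsets pairs_eq_choose)
  have E: "finite ?E" "card ?E = pairs n"
    by (auto simp: finite_imp_finite_nsets card_nsets pairs_eq_choose)
  have "occurrence H A S \<longleftrightarrow> A \<inter> ?D = J" if "A \<subseteq> ?E" for A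
    unfolding occurrence_iff[OF S H that] J_def by blast
  then have "{A \<in> Pow ?E. occurrence H A S} = {A \<in> Pow ?E. A \<inter> ?D = J}"
    by auto
  also have "\<dots> = (\<lambda>B. J \<union> B) ` Pow (?E - ?D)"
  proof (intro equalityI subsetI)
    fix A
    assume "A \<in> {A \<in> Pow ?E. A \<inter> ?D = J}"
    then have "A = J \<union> (A - ?D)" "A - ?D \<in> Pow (?E - ?D)"
      by auto
    then show "A \<in> (\<lambda>B. J \<union> B) ` Pow (?E - ?D)"
      by blast
  next
    fix A
    assume "A \<in> (\<lambda>B. J \<union> B) ` Pow (?E - ?D)"
    moreover have "J \<subseteq> ?D"
      by (auto simp: J_def)
    ultimately show "A \<in> {A \<in> Pow ?E. A \<inter> ?D = J}"
      using D(1) by blast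
  qed
  also have "card \<dots> = card (Pow (?E - ?D))"
  proof (rule card_image, rule inj_onI)
    fix B B'
    assume "B \<in> Pow (?E - ?D)" "B' \<in> Pow (?E - ?D)" "J \<union> B = J \<union> B'"
    moreover have "J \<subseteq> ?D"
      by (auto simp: J_def)
    ultimately show "B = B'"
      by blast
  qed
  also have "\<dots> = 2 ^ (pairs n - pairs k)"
    using D E by (simp add: card_Pow card_Diff_subset)
  finally have "real (card {A \<in> Pow ?E. occurrence H A S}) = 2 ^ (pairs n - pairs k)"
    by (simp only: of_nat_power of_nat_numeral)
  also have "\<dots> = 2 ^ pairs n / 2 ^ pairs k"
    using card_mono[OF E(1) D(1)] D(3) E(2) by (simp add: power_diff)
  finally show ?thesis .
qed

lemma mean_occurrences:
  assumes "H \<subseteq> nsets {1..k} 2"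
  shows "(\<Sum>A\<in>Pow (nsets {1..n} 2). real (occurrences k H n A)) / 2 ^ card (nsets {1..n} 2)
    = real (n choose k) / 2 ^ pairs k"
proof -
  let ?E = "nsets {1..n} 2" and ?S = "nsets {1..n} k"
  have fin: "finite ?S" "finite (Pow ?E)"
    by (auto simp: finite_imp_finite_nsets)
  have "real (occurrences k H n A) = (\<Sum>S\<in>?S. of_bool (occurrence H A S))" for A
    using fin(1) by (simp add: occurrences_def Collect_conj_eq)
  then have "(\<Sum>A\<in>Pow ?E. real (occurrences k H n A)) = (\<Sum>S\<in>?S. \<Sum>A\<in>Pow ?E. of_bool (occurrence H A S))"
    by (simp only: sum.swap[of _ "?S"])
  also have "\<dots> = (\<Sum>S\<in>?S. real (card {A \<in> Pow ?E. occurrence H A S}))"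
    using fin(2) by (intro sum.cong) (simp_all add: Collect_conj_eq Pow_def)
  also have "\<dots> = (\<Sum>S\<in>?S. 2 ^ pairs n / 2 ^ pairs k)"
    using assms by (intro sum.cong card_occurrence) auto
  also have "\<dots> = real (n choose k) * (2 ^ pairs n / 2 ^ pairs k)"
    by (simp add: card_nsets)
  finally show ?thesis
    by (simp add: card_nsets pairs_eq_choose)
qed

text \<open>Only node sets that contain both ends of \<open>e\<close> can notice the change.\<close>

lemma occurrences_insert_edge:
  assumes "e \<in> nsets {1..n} 2" "2 \<le> k"
  shows "\<bar>real (occurrences k H n (insert e A)) - real (occurrences k H n A)\<bar> \<le> real ((n - 2) choose (k - 2))"
proof -
  let ?S = "nsets {1..n} k"
  let ?X = "{S \<in> ?S. occurrence H (insert e A) S}" and ?Y = "{S \<in> ?S. occurrence H A S}"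
    and ?Z = "{S \<in> ?S. e \<subseteq> S}"
  have fin: "finite ?S"
    by (simp add: finite_imp_finite_nsets)
  have "occurrence H (insert e A) S \<longleftrightarrow> occurrence H A S" if "\<not> e \<subseteq> S" for S
  proof -
    have "induced (insert e A) S = induced A S"
      using that by (auto simp: induced_def)
    then show ?thesis
      by (simp add: occurrence_def)
  qed
  then have "?X \<subseteq> ?Y \<union> ?Z" "?Y \<subseteq> ?X \<union> ?Z"
    by auto
  then have "card ?X \<le> card (?Y \<union> ?Z)" "card ?Y \<le> card (?X \<union> ?Z)"
    using fin by (auto intro!: card_mono)
  then have diff: "card ?X \<le> card ?Y + card ?Z" "card ?Y \<le> card ?X + card ?Z"
    by (meson card_Un_le order_trans)+
  have e: "finite e" "card e = 2" "e \<subseteq> {1..n}"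
    using assms(1) by (auto simp: nsets_def)
  have "card ?Z \<le> card (nsets ({1..n} - e) (k - 2))"
  proof (rule card_inj_on_le)
    show "inj_on (\<lambda>S. S - e) ?Z"
      by (rule inj_onI) blast
    show "(\<lambda>S. S - e) ` ?Z \<subseteq> nsets ({1..n} - e) (k - 2)"
      using e by (auto simp: nsets_def card_Diff_subset)
  qed (simp add: finite_imp_finite_nsets)
  also have "\<dots> = (n - 2) choose (k - 2)"
    using e by (simp add: card_nsets card_Diff_subset)
  finally show ?thesis
    using diff unfolding occurrences_def by linarith
qed

section \<open>Numerical estimates\<close>

lemma le_binomial: "1 \<le> j \<Longrightarrow> j < m \<Longrightarrow> m \<le> m choose j"
proof (induction m)
  case (Suc m)
  show ?case
  proof (cases "j = m")
    case False
    then have "m \<le> m choose j"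
      using Suc by simp
    moreover have "0 < m choose (j - 1)"
      using Suc.prems by simp
    moreover have "Suc m choose j = (m choose (j - 1)) + (m choose j)"
      using Suc.prems by (cases j) auto
    ultimately show ?thesis
      by linarith
  qed (use Suc in \<open>simp add: binomial_Suc_n\<close>)
qed simp

lemma half_square_bound:
  assumes "0 < n" "real k \<le> sqrt (2 * log 2 (real n))"
  shows "2 ^ (k * k div 2) \<le> n"
proof -
  have "(real k)\<^sup>2 \<le> (sqrt (2 * log 2 (real n)))\<^sup>2"
    using assms(2) by (intro power_mono) auto
  also have "\<dots> = 2 * log 2 (real n)"
    using assms(1) by simp
  finally have "(real k)\<^sup>2 \<le> 2 * log 2 (real n)" .
  moreover have "real (2 * (k * k div 2)) \<le> real (k * k)"
    by (simp only: of_nat_le_iff)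
  ultimately have "real (k * k div 2) \<le> log 2 (real n)"
    by (simp add: power2_eq_square)
  then have "2 powr real (k * k div 2) \<le> real n"
    using assms(1) by (simp add: le_log_iff)
  then have "real (2 ^ (k * k div 2)) \<le> real n"
    by (simp add: powr_realpow)
  then show ?thesis
    by (simp only: of_nat_le_iff)
qed

text \<open>The sixth power, since its square root, the cube, is to be compared with
  \<open>2 ^ (k / 2)\<close>. At 29 the inequality fails; from 30 on
  \<open>(31 / 30) ^ 6 < 2\<close> carries the induction.\<close>

lemma power6_le_power2: "30 \<le> k \<Longrightarrow> k ^ 6 \<le> (2 :: nat) ^ k"
proof (induction k rule: dec_induct)
  case (step k)
  have "(30 * Suc k) ^ 6 \<le> (31 * k) ^ 6"
    using step.hyps by (intro power_mono) auto
  also have "\<dots> \<le> 2 * 30 ^ 6 * k ^ 6"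
    by (simp add: power_mult_distrib)
  finally have "30 ^ 6 * Suc k ^ 6 \<le> 30 ^ 6 * (2 * k ^ 6)"
    by (simp only: power_mult_distrib ac_simps)
  then have "Suc k ^ 6 \<le> 2 * k ^ 6"
    by simp
  then show ?case
    using step.IH by simp
qed simp

text \<open>Of \<open>2 ^ (k * k div 2)\<close> the factor \<open>2 ^ pairs k\<close> is used up and
  \<open>2 ^ (k div 2)\<close> remains against the cube. The finitely many smaller \<open>k\<close>
  are bounded together and go into \<open>n0\<close>.\<close>

lemma cube_bound: "\<exists>n0 \<ge> 2. \<forall>n\<ge>n0. \<forall>k. 2 ^ (k * k div 2) \<le> n \<longrightarrow> k ^ 3 * 2 ^ pairs k \<le> 3 * n"
proof -
  have "finite ((\<lambda>k. k ^ 3 * 2 ^ pairs k) ` {..<30})"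
    by (intro finite_imageI finite_lessThan)
  then obtain b where b: "k ^ 3 * 2 ^ pairs k \<le> b" if "k < 30" for k
    unfolding finite_nat_set_iff_bounded_le by auto
  have "k ^ 3 * 2 ^ pairs k \<le> 3 * n" if n: "max 2 b \<le> n" and k: "2 ^ (k * k div 2) \<le> n" for n k
  proof (cases "k < 30")
    case True
    then show ?thesis
      using b[of k] n by simp
  next
    case False
    then have "(k ^ 3)\<^sup>2 \<le> 2 ^ k"
      using power6_le_power2[of k] by (simp flip: power_mult)
    \<comment> \<open>For odd \<open>k\<close> rounding costs a factor 2 here, which the factor 3,
      squared to 9, absorbs.\<close>
    also have "\<dots> \<le> 2 ^ Suc (2 * (k div 2))"
      by (intro power_increasing) auto
    also have "\<dots> \<le> (3 * 2 ^ (k div 2))\<^sup>2"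
      by (simp add: power_mult_distrib power_mult power2_eq_square flip: power_add mult_2)
    finally have "k ^ 3 \<le> 3 * 2 ^ (k div 2)"
      by (rule power2_le_imp_le) simp
    then have "k ^ 3 * 2 ^ pairs k \<le> 3 * 2 ^ (k div 2) * 2 ^ pairs k"
      by (rule mult_le_mono1)
    also have "\<dots> = 3 * 2 ^ (k * k div 2)"
      by (simp add: pairs_add_half[symmetric] power_add)
    finally show ?thesis
      using k by linarith
  qed
  then show ?thesis
    by (intro exI[of _ "max 2 b"]) simp
qed

section \<open>Atypicality of large deviations\<close>

lemma real_pairs: "real (pairs k) = real k * (real k - 1) / 2"
  by (induction k) (auto simp: pairs_def field_simps)

text \<open>Applying the absorption identity twice expresses \<open>n choose k\<close> by
  \<open>b\<close>. The right side divided by the left is then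
  \<open>6 (x - 1) / (y (y - 1)^2 2 ^ pairs k)\<close>, at least 1 by the cubic hypothesis and
  \<open>3 x \<le> 6 (x - 1)\<close>.\<close>

lemma variance_bound:
  assumes "2 \<le> k" "k < n" "k ^ 3 * 2 ^ pairs k \<le> 3 * n"
  shows "real (pairs n) * (real ((n - 2) choose (k - 2)))\<^sup>2 \<le>
    3 * (real (n choose k))\<^sup>2 * (real k / real n) / 2 ^ pairs k"
proof -
  define b where "b = real ((n - 2) choose (k - 2))"
  define x where "x = real n"
  define y where "y = real k"
  have xy: "2 \<le> y" "y + 1 \<le> x"
    using assms(1,2) by (auto simp: x_def y_def)
  have "k * (n choose k) = n * ((n - 1) choose (k - 1))"
    using assms(1) by (intro times_binomial_minus1_eq) simp
  moreover have "(k - 1) * ((n - 1) choose (k - 1)) = (n - 1) * ((n - 2) choose (k - 2))"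
    using assms(1) times_binomial_minus1_eq[of "k - 1" "n - 1"] by (simp add: numeral_2_eq_2)
  ultimately have "k * (k - 1) * (n choose k) = n * (n - 1) * ((n - 2) choose (k - 2))"
    by (metis (no_types, opaque_lifting) mult.assoc mult.left_commute)
  then have "real (k * (k - 1) * (n choose k)) = real (n * (n - 1) * ((n - 2) choose (k - 2)))"
    by (rule arg_cong)
  then have "y * (y - 1) * real (n choose k) = x * (x - 1) * b"
    using assms by (simp add: x_def y_def b_def of_nat_diff)
  then have C: "real (n choose k) = x * (x - 1) * b / (y * (y - 1))"
    using xy by (simp add: field_simps)
  have "real (k ^ 3 * 2 ^ pairs k) \<le> real (3 * n)"
    using assms(3) by (simp only: of_nat_le_iff)
  then have "y ^ 3 * 2 ^ pairs k \<le> 3 * x"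
    by (simp add: x_def y_def)
  also have "\<dots> \<le> 6 * (x - 1)"
    using xy by simp
  finally have "y ^ 3 * 2 ^ pairs k \<le> 6 * (x - 1)" .
  moreover have "y * (y - 1)\<^sup>2 * 2 ^ pairs k \<le> y ^ 3 * 2 ^ pairs k"
    unfolding power3_eq_cube mult.assoc[of y y y] power2_eq_square
    using xy by (intro mult_right_mono mult_left_mono mult_mono) auto
  ultimately have "y * (y - 1)\<^sup>2 * 2 ^ pairs k \<le> 6 * (x - 1)"
    by (rule order_trans[rotated])
  moreover have "0 < y * (y - 1)\<^sup>2 * 2 ^ pairs k"
    using xy by simp
  ultimately have "1 \<le> 6 * (x - 1) / (y * (y - 1)\<^sup>2 * 2 ^ pairs k)"
    by (simp add: pos_le_divide_eq)
  then have "x * (x - 1) / 2 * b\<^sup>2 * 1 \<le> x * (x - 1) / 2 * b\<^sup>2 * (6 * (x - 1) / (y * (y - 1)\<^sup>2 * 2 ^ pairs k))"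
    using xy by (intro mult_left_mono) auto
  also have "\<dots> = 3 * (real (n choose k))\<^sup>2 * (y / x) / 2 ^ pairs k"
    using xy unfolding C by (simp add: divide_simps power2_eq_square)
  finally show ?thesis
    by (simp add: real_pairs b_def x_def y_def)
qed

text \<open>\<open>L\<close> is the tail exponent in base 2: by \<open>variance_bound\<close> the 3
  cancels, and \<open>ln 2\<close> turns the exponential into \<open>2 powr - L\<close>.\<close>

lemma large_deviation_atypical:
  fixes n k g e r :: nat and L :: real
  defines "D \<equiv> \<bar>real (occurrences k (graph_of k e) n (graph_of n g)) - real (n choose k) / 2 ^ pairs k\<bar>"
  assumes k: "2 \<le> k" "k < n" "k ^ 3 * 2 ^ pairs k \<le> 3 * n" "2 ^ (k * k div 2) \<le> n"
    and e: "e < 2 ^ pairs k"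
    and L: "real r + 2 + log 2 (real ((n - 1) choose (k - 1))) \<le> L" "0 \<le> L"
    and D: "(real (n choose k))\<^sup>2 * (L * (3 * ln 2)) * (real k / real n) / 2 ^ pairs k \<le> D\<^sup>2"
  shows "atypical n r g"
proof -
  let ?E = "nsets {1..n} 2" and ?f = "\<lambda>A. real (occurrences k (graph_of k e) n A)"
  define b where "b = real ((n - 2) choose (k - 2))"
  define Q where "Q = (n - 1) choose (k - 1)"
  have E: "finite ?E" "card ?E = pairs n"
    by (simp_all add: finite_imp_finite_nsets card_nsets pairs_eq_choose)
  have "pairs n \<noteq> 0"
    using k unfolding pairs_eq_choose by simp
  then have "?E \<noteq> {}"
    using E(2) by (metis card.empty)
  have "0 < b"
    using k by (simp add: b_def)
  have "real (deviation_rank n k e g) \<le> real (card {A \<in> Pow ?E. D \<le> \<bar>?f A - real (n choose k) / 2 ^ pairs k\<bar>})"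
    unfolding of_nat_le_iff by (rule deviation_rank_le_card) (simp add: D_def)
  also have "\<dots> \<le> 2 * 2 ^ card ?E * exp (- D\<^sup>2 / (card ?E * b\<^sup>2))"
    unfolding mean_occurrences[OF graph_of_subset[of k e], of n, symmetric] b_def
    by (intro card_deviation_Pow E(1) \<open>?E \<noteq> {}\<close> occurrences_insert_edge)
      (use k \<open>0 < b\<close> in \<open>auto simp: D_def b_def\<close>)
  also have "\<dots> \<le> 2 * 2 ^ pairs n * 2 powr - L"
  proof -
    have "L * ln 2 * (pairs n * b\<^sup>2) \<le> L * ln 2 * (3 * (real (n choose k))\<^sup>2 * (real k / real n) / 2 ^ pairs k)"
      unfolding b_def using k L(2) by (intro mult_left_mono variance_bound) auto
    also have "\<dots> \<le> D\<^sup>2"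
      using D by (simp add: mult_ac)
    finally have "L * ln 2 \<le> D\<^sup>2 / (pairs n * b\<^sup>2)"
      using \<open>0 < b\<close> \<open>pairs n \<noteq> 0\<close> by (simp add: pos_le_divide_eq)
    then have "exp (- D\<^sup>2 / (pairs n * b\<^sup>2)) \<le> 2 powr - L"
      by (simp add: powr_def)
    then show ?thesis
      unfolding E(2) by (rule mult_left_mono) simp
  qed
  finally have rank: "real (deviation_rank n k e g) \<le> 2 * 2 ^ pairs n * 2 powr - L" .
  \<comment> \<open>Only \<open>n \<le> 2 * Q\<close> is available, which costs one of the two bits
    in \<open>real r + 2\<close>; the other one pays for the two tails in
    \<open>rank\<close>.\<close>
  have "n - 1 \<le> Q"
    unfolding Q_def using k by (intro le_binomial) auto
  then have "n \<le> 2 * Q" "0 < Q"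
    using k by auto
  have "real (2 ^ (k * k div 2)) \<le> real (2 * Q)"
    using k(4) \<open>n \<le> 2 * Q\<close> unfolding of_nat_le_iff by (rule order_trans)
  then have w: "2 ^ (k * k div 2) \<le> 2 * 2 powr log 2 Q"
    using \<open>0 < Q\<close> by simp
  have "real (deviation_rank n k e g * 2 ^ (r + k * k div 2)) = real (deviation_rank n k e g) * 2 ^ r * 2 ^ (k * k div 2)"
    by (simp add: power_add)
  also have "\<dots> \<le> 2 * 2 ^ pairs n * 2 powr - L * 2 ^ r * (2 * 2 powr log 2 Q)"
    using rank w by (intro mult_mono) auto
  also have "\<dots> = 2 ^ pairs n * 2 powr (real r + 2 + log 2 Q - L)"
    by (simp add: powr_add powr_diff powr_minus powr_realpow field_simps)
  also have "\<dots> \<le> 2 ^ pairs n * 2 powr 0"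
    using L(1) by (intro mult_left_mono powr_mono) (auto simp: Q_def)
  finally have "real (deviation_rank n k e g * 2 ^ (r + k * k div 2)) \<le> real (2 ^ pairs n)"
    by simp
  then have "deviation_rank n k e g * 2 ^ (r + k * k div 2) \<le> 2 ^ pairs n"
    by (simp only: of_nat_le_iff)
  then show ?thesis
    unfolding atypical_def using e k(2) by (intro exI[of _ k] conjI exI[of _ e]) auto
qed

text \<open>Serves to get \<open>1 \<le> 3 * ln 2\<close>, so that \<alpha> is at least its additive
  constant.\<close>

lemma half_le_ln_2: "1 / 2 \<le> ln (2 :: real)"
proof -
  have "exp (1 / 2) \<le> (2 :: real)"
    using exp_bound[of "1 / 2"] by (simp add: power2_eq_square)
  then show ?thesis
    by (subst ln_ge_iff) auto
qed

lemma labeled_graphE: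
  assumes "labeled_graph n G"
  obtains g where "g < 2 ^ pairs n" "graph_of n g = G"
proof -
  have "G \<in> graph_of n ` {..<2 ^ pairs n}"
    using bij_graph_of[of n] assms by (simp add: bij_betw_def labeled_graph_def)
  then show ?thesis
    using that by blast
qed

text \<open>For one node the bound with \<open>k - 2\<close> says nothing, but here
  \<open>p = 1\<close> and the count is exact.\<close>

lemma occurrences_1:
  assumes "labeled_graph 1 H" "labeled_graph n G"
  shows "occurrences 1 H n G = n"
proof -
  have "occurrence H G S" if S: "S \<in> nsets {1..n} 1" for S
  proof -
    have "nsets S 2 = {}"
      using S by (intro nsets_eq_empty) (auto simp: nsets_def)
    then show ?thesis
      using occurrence_iff[OF S] assms unfolding labeled_graph_def by blast
  qed
  then have "{S \<in> nsets {1..n} 1. occurrence H G S} = nsets {1..n} 1"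
    by blast
  then show ?thesis
    by (simp only: occurrences_def) (simp only: card_nsets finite_atLeastAtMost card_atLeastAtMost, simp)
qed

lemma occurrences_le_choose: "occurrences k H n G \<le> n choose k"
proof -
  have "occurrences k H n G \<le> card (nsets {1..n} k)"
    unfolding occurrences_def by (intro card_mono) (auto simp: finite_imp_finite_nsets)
  then show ?thesis
    by (simp add: card_nsets)
qed

theorem theorem2p9:
  fixes U V :: tm and \<delta> :: "nat \<Rightarrow> real"
  assumes "universal_for turing_machine U"
    and "universal_for prefix_machine V"
    and "\<And>n. \<delta> n \<ge> 0"
  shows "\<exists>c :: real. \<forall>n k :: nat. \<forall>H G :: nat set set.
           n > 0 \<and> k > 0 \<and> k dvd n \<and> real k \<le> sqrt (2 * log 2 (real n)) \<and>
           labeled_graph k H \<and> labeled_graph n G \<and>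
           real (complexity U (encode n G) (str n)) \<ge> real (n choose 2) - \<delta> n \<longrightarrow>
           (let p = 2 powr (- (real k * (real k - 1) / 2));
                \<alpha> = (real (complexity V (encode k H) (str n)) + \<delta> n
                      + log 2 (real (n choose k) / (real n / real k)) + c)
                    * (3 / log 2 (exp 1))
            in \<bar>real (occurrences k H n G) - real (n choose k) * p\<bar>
                 \<le> real (n choose k) * sqrt (\<alpha> * (real k / real n) * p))"
proof -
  obtain d where d: "\<And>n r g. g < 2 ^ pairs n \<Longrightarrow> atypical n r g \<Longrightarrow>
    complexity U (map (bit g) [0..<pairs n]) (str n) + r \<le> pairs n + d"
    using complexity_atypical[OF assms(1)] by blast
  obtain n0 where n0: "\<And>n k. n0 \<le> n \<Longrightarrow> 2 ^ (k * k div 2) \<le> n \<Longrightarrow> k ^ 3 * 2 ^ pairs k \<le> 3 * n"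
    using cube_bound by blast
  \<comment> \<open>In the first entry \<open>d\<close> is the overhead of simulation and 3 covers
    rounding \<open>\<delta> n\<close> to the level \<open>r\<close> and the 2 in
    \<open>real r + 2\<close>. The second entry makes the bound trivial for
    \<open>n < n0\<close>.\<close>
  define c where "c = max (real d + 3) (real n0 * 2 ^ pairs n0)"
  have bound: "\<bar>real (occurrences k H n G) - real (n choose k) * p\<bar> \<le> real (n choose k) * sqrt (\<alpha> * (real k / real n) * p)"
    if n: "0 < n" "0 < k" "k dvd n" "real k \<le> sqrt (2 * log 2 (real n))"
      and H: "labeled_graph k H" and G: "labeled_graph n G"
      and incompressible: "real (n choose 2) - \<delta> n \<le> real (complexity U (encode n G) (str n))"
      and p: "p = 2 powr (- (real k * (real k - 1) / 2))"
      and \<alpha>: "\<alpha> = (real (complexity V (encode k H) (str n)) + \<delta> n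
                      + log 2 (real (n choose k) / (real n / real k)) + c) * (3 / log 2 (exp 1))"
    for n k H G p \<alpha>
  proof -
    let ?X = "real (occurrences k H n G)" and ?C = "real (n choose k)"
    define L where "L = real (complexity V (encode k H) (str n)) + \<delta> n
      + log 2 (real ((n - 1) choose (k - 1))) + c"
    have "k \<le> n"
      using n by (intro dvd_imp_le)
    have p': "p = 1 / 2 ^ pairs k"
      unfolding p real_pairs[symmetric] by (simp add: powr_minus powr_realpow inverse_eq_divide)
    have "real (k * (n choose k)) = real (n * ((n - 1) choose (k - 1)))"
      using n(2) by (simp only: times_binomial_minus1_eq)
    \<comment> \<open>The quotient is itself a binomial coefficient, hence at least 1, and its
      logarithm is nonnegative.\<close>
    then have "?C / (real n / real k) = real ((n - 1) choose (k - 1))"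
      using n by (simp add: field_simps)
    then have \<alpha>': "\<alpha> = L * (3 * ln 2)"
      unfolding \<alpha> L_def by (simp add: log_def)
    have "1 \<le> real ((n - 1) choose (k - 1))"
      using \<open>k \<le> n\<close> by (simp add: Suc_le_eq)
    then have "0 \<le> log 2 (real ((n - 1) choose (k - 1)))"
      by (subst zero_le_log_cancel_iff) linarith+
    then have "c \<le> L"
      unfolding L_def using assms(3)[of n] by linarith
    have "0 \<le> c"
      by (simp add: c_def)
    have "c * 1 \<le> L * (3 * ln 2)"
      using \<open>c \<le> L\<close> \<open>0 \<le> c\<close> half_le_ln_2 by (intro mult_mono) auto
    then have "c \<le> \<alpha>"
      by (simp add: \<alpha>')
    then have nonneg: "0 \<le> \<alpha> * (real k / real n) * p"
      using \<open>0 \<le> c\<close> by (simp add: p')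
    have half: "2 ^ (k * k div 2) \<le> n"
      using n by (intro half_square_bound)
    consider "k = 1" | "2 \<le> k" "n < n0" | "2 \<le> k" "n0 \<le> n"
      using n(2) by linarith
    then show ?thesis
    proof cases
      case 1
      then show ?thesis
        using occurrences_1[of H n G] H G nonneg by (simp add: p' pairs_def)
    next
      case 2
      \<comment> \<open>By the choice of \<open>c\<close> the factor under the root is at least 1,
        so the claimed bound is at least \<open>?C\<close>. No deviation exceeds that, as the count
        and its mean both lie between 0 and \<open>?C\<close>.\<close>
      have "pairs k \<le> pairs n0"
        unfolding pairs_def using 2 \<open>k \<le> n\<close> by (intro sum_mono2) auto
      then have "real n * 2 ^ pairs k \<le> real n0 * 2 ^ pairs n0"
        using 2 by (intro mult_mono power_increasing) auto
      also have "\<dots> \<le> \<alpha>"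
        using \<open>c \<le> \<alpha>\<close> by (simp add: c_def)
      also have "\<dots> \<le> \<alpha> * real k"
        using n(2) \<open>0 \<le> c\<close> \<open>c \<le> \<alpha>\<close> by (intro mult_le_cancel_left1[THEN iffD2]) auto
      finally have "1 \<le> \<alpha> * (real k / real n) * p"
        using n(1) by (simp add: p' field_simps)
      then have "?C * 1 \<le> ?C * sqrt (\<alpha> * (real k / real n) * p)"
        by (intro mult_left_mono) auto
      moreover have "0 \<le> p" "p \<le> 1"
        by (simp_all add: p')
      then have "0 \<le> ?C * p" "?C * p \<le> ?C"
        by (auto intro: mult_left_le)
      moreover have "?X \<le> ?C"
        using occurrences_le_choose[of k H n G] by simp
      ultimately show ?thesis
        by linarith
    next
      case 3
      have "k < n"
      proof (rule ccontr)
        assume "\<not> k < n"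
        then have "k = n"
          using \<open>k \<le> n\<close> by simp
        then have "n \<le> k * k div 2"
          using 3 by (simp add: less_eq_div_iff_mult_less_eq)
        then have "n < 2 ^ (k * k div 2)"
          by (meson less_exp less_le_trans one_le_numeral power_increasing)
        then show False
          using half by simp
      qed
      obtain g where g: "g < 2 ^ pairs n" "graph_of n g = G"
        using G by (rule labeled_graphE)
      obtain e where e: "e < 2 ^ pairs k" "graph_of k e = H"
        using H by (rule labeled_graphE)
      \<comment> \<open>A level just above \<open>\<delta> n + d\<close>: saving \<open>r\<close>
        bits at an overhead of \<open>d\<close> pushes the complexity strictly below
        \<open>pairs n - \<delta> n\<close>.\<close>
      define r where "r = nat \<lfloor>\<delta> n\<rfloor> + d + 1"
      have r: "real r \<le> \<delta> n + d + 1" "\<delta> n + d < real r"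
        using assms(3)[of n] by (auto simp: r_def of_nat_nat) linarith+
      show ?thesis
      proof (rule ccontr)
        assume "\<not> ?thesis"
        then have "?C * sqrt (\<alpha> * (real k / real n) * p) \<le> \<bar>?X - ?C * p\<bar>"
          by simp
        then have "(?C * sqrt (\<alpha> * (real k / real n) * p))\<^sup>2 \<le> \<bar>?X - ?C * p\<bar>\<^sup>2"
          using nonneg by (intro power_mono) auto
        then have "?C\<^sup>2 * (\<alpha> * (real k / real n) * p) \<le> \<bar>?X - ?C * p\<bar>\<^sup>2"
          using nonneg by (simp add: power_mult_distrib)
        then have "?C\<^sup>2 * (L * (3 * ln 2)) * (real k / real n) / 2 ^ pairs k \<le> \<bar>?X - ?C / 2 ^ pairs k\<bar>\<^sup>2"
          by (simp add: \<alpha>' p' mult_ac)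
        moreover have "real r + 2 + log 2 (real ((n - 1) choose (k - 1))) \<le> L" "0 \<le> L"
          using r(1) \<open>0 \<le> c\<close> \<open>c \<le> L\<close> by (auto simp: L_def c_def)
        ultimately have "atypical n r g"
          using 3 \<open>k < n\<close> half n0[OF _ half] e g by (intro large_deviation_atypical[where k = k and e = e and L = L]) auto
        then have "complexity U (encode n G) (str n) + r \<le> pairs n + d"
          using d[OF g(1)] g(2) encode_graph_of[of n g] by simp
        then have "real (complexity U (encode n G) (str n)) + real r \<le> real (pairs n) + real d"
          by (simp only: of_nat_le_iff flip: of_nat_add)
        then show False
          using incompressible r(2) by (simp add: pairs_eq_choose)
      qed
    qed
  qed
  show ?thesis
    unfolding Let_def
    by (intro exI[of _ c] allI impI, elim conjE, rule bound; (assumption | rule refl))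
qed

end
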